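(* Let $\mathcal S$ be a finite set and let $\kappa_N\in[0,\infty)^{\mathcal S\times\mathcal S}$, $N\in\mathbb N$, be symmetric matrices converging entrywise to a symmetric matrix $\kappa\in[0,\infty)^{\mathcal S\times\mathcal S}$. Fix $y\in[0,1]^{\mathcal S}$, $y\ne0$, and let $(k^{(N)})_{N\in\mathbb N}$ be a sequence in $\mathbb N_0^{\mathcal S}$ with $\lim_{N\to\infty}\frac{k^{(N)}_r}N=y_r$ for all $r\in\mathcal S$. (i) Then $$\limsup_{N\to\infty}\frac1N\log p_N(k^{(N)})\le\sum_{r\in\mathcal S}y_r\log\big(1-e^{-(\kappa y)_r}\big),$$ where the right-hand side takes the value $-\infty$ when $y\not\ll\kappa y$. (ii) Assume that $\tau(k^{(N)})>0$ for all but finitely many $N\in\mathbb N$ and that $(k_r^{(N)})_N$ is bounded in $N$ for all $r\notin\mathrm{supp}(y)$. Then $$\lim_{N\to\infty}\frac1N\log p_N(k^{(N)})=\sum_{r\in\mathcal S}y_r\log\big(1-e^{-(\kappa y)_r}\big)\in[-\infty,0],$$ where the right-hand side takes the value $-\infty$ when $y\not\ll\kappa y$.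
   Context: For $k\in\mathbb N_0^{\mathcal S}$ put $|k|=\sum_sk_s$; a vector $\mathbf x=(x_1,\dots,x_{|k|})\in\mathcal S^{|k|}$ is compatible with $k$ if each $s\in\mathcal S$ occurs exactly $k_s$ times in it. $(\kappa y)_r=\sum_s\kappa(r,s)y_s$; $y\ll\kappa y$ means $(\kappa y)_r=0\Rightarrow y_r=0$; $\mathrm{supp}(y)=\{r:y_r>0\}$; terms with $y_r=0$ count as $0$; $\log 0=-\infty$. For $k\ne0$, $p_N(k)$ is the probability that the random simple graph $\mathcal G(|k|,\mathbf x,\frac1N\kappa_N)$ on vertex set $\{1,\dots,|k|\}$, with $\mathbf x$ compatible with $k$, in which each pair $i\ne j$ is joined independently with probability $1\wedge\frac1N\kappa_N(x_i,x_j)$, is connected; $p_N(0)=0$. $\tau(k)=\sum_T\prod_{\{i,j\}\in E(T)}\kappa(x_i,x_j)$, the sum over all spanning trees $T$ on $\{1,\dots,|k|\}$, with $\mathbf x$ compatible with $k$; $\tau(0)=0$. *)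

theory Defs
  imports "HOL-Probability.Probability" "HOL-Library.Multiset"
begin

text \<open>The finite set of types is the universe of a type variable of class finite; vectors and
  matrices indexed by it are \<^typ>\<open>real^'s\<close>, \<^typ>\<open>nat^'s\<close> and \<^typ>\<open>real^'s^'s\<close>.\<close>

section \<open>Finite simple graphs\<close>

text \<open>An undirected simple graph on \<open>{1..n}\<close> is given by its edge set, a set of two-element
  sets of vertices.\<close>

definition vertex_pairs :: "nat \<Rightarrow> nat set set" where
  "vertex_pairs n = {e. e \<subseteq> {1..n} \<and> card e = 2}"

definition graph_connected :: "'v set \<Rightarrow> 'v set set \<Rightarrow> bool" where
  "graph_connected V E \<longleftrightarrow>
     V \<noteq> {} \<and> (\<forall>u\<in>V. \<forall>v\<in>V. (u, v) \<in> {(a, b). {a, b} \<in> E}\<^sup>*)"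

definition graph_cycle :: "'v set set \<Rightarrow> 'v list \<Rightarrow> bool" where
  "graph_cycle E c \<longleftrightarrow> 3 \<le> length c \<and> distinct c \<and>
     (\<forall>i<length c. {c ! i, c ! (Suc i mod length c)} \<in> E)"

definition spanning_trees :: "nat \<Rightarrow> nat set set set" where
  "spanning_trees n =
     {T. T \<subseteq> vertex_pairs n \<and> graph_connected {1..n} T \<and> (\<nexists>c. graph_cycle T c)}"

section \<open>Compatible type assignments\<close>

definition total_count :: "nat^'s::finite \<Rightarrow> nat" where
  "total_count k = (\<Sum>s\<in>UNIV. k $ s)"

text \<open>The vector \<open>(x\<^sub>1, \<dots>, x\<^sub>|\<^sub>k\<^sub>|)\<close> is a function on \<^typ>\<open>nat\<close>
  of which only the values on \<open>{1..total_count k}\<close> matter.\<close>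

definition compatible :: "(nat \<Rightarrow> 's::finite) \<Rightarrow> nat^'s \<Rightarrow> bool" where
  "compatible x k \<longleftrightarrow> (\<forall>s. card {i\<in>{1..total_count k}. x i = s} = k $ s)"

text \<open>\<open>edge_val A x {i, j} = A $ x i $ x j\<close>. For symmetric \<open>A\<close>, the only case of interest,
  the order of the two endpoints is irrelevant (see \<open>edge_val_doubleton\<close> below).\<close>

definition edge_val :: "real^'s^'s \<Rightarrow> (nat \<Rightarrow> 's::finite) \<Rightarrow> nat set \<Rightarrow> real" where
  "edge_val A x e = A $ x (Min e) $ x (Max e)"

section \<open>The random graph, its connection probability, and the weight of spanning trees\<close>

definition random_graph :: "nat \<Rightarrow> (nat \<Rightarrow> 's::finite) \<Rightarrow> real^'s^'s \<Rightarrow> nat set set pmf" where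
  "random_graph n x A = map_pmf (\<lambda>f. {e \<in> vertex_pairs n. f e})
     (Pi_pmf (vertex_pairs n) False (\<lambda>e. bernoulli_pmf (min 1 (edge_val A x e))))"

text \<open>\<open>conn_prob \<kappa>\<^sub>N N k\<close> is \<open>p\<^sub>N(k)\<close>. Compatible vectors exist, and
  for symmetric matrices the choice of one affects neither \<open>conn_prob\<close> nor \<open>tree_weight\<close>
  (which is \<open>\<tau>\<close>): see \<open>compatible_exists\<close>, \<open>conn_prob_eq\<close> and \<open>tree_weight_eq\<close> below.\<close>

definition conn_prob :: "real^'s^'s \<Rightarrow> nat \<Rightarrow> nat^'s::finite \<Rightarrow> real" where
  "conn_prob A N k = (if k = 0 then 0 else
     measure_pmf.prob
       (random_graph (total_count k) (SOME x. compatible x k) ((1 / real N) *\<^sub>R A))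
       {E. graph_connected {1..total_count k} E})"

definition tree_weight :: "real^'s^'s \<Rightarrow> nat^'s::finite \<Rightarrow> real" where
  "tree_weight A k = (if k = 0 then 0 else
     \<Sum>T\<in>spanning_trees (total_count k). \<Prod>e\<in>T. edge_val A (SOME x. compatible x k) e)"

section \<open>The limit\<close>

text \<open>Logarithm on \<open>[0,\<infinity>)\<close> with \<open>log 0 = -\<infinity>\<close>; only applied to nonnegative numbers.\<close>

definition elog :: "real \<Rightarrow> ereal" where
  "elog x = (if x \<le> 0 then -\<infinity> else ereal (ln x))"

definition supp :: "real^'s::finite \<Rightarrow> 's set" where
  "supp y = {r. y $ r > 0}"

definition dominated :: "real^'s::finite \<Rightarrow> real^'s \<Rightarrow> bool" (infix "\<lless>" 50) where
  "y \<lless> z \<longleftrightarrow> (\<forall>r. z $ r = 0 \<longrightarrow> y $ r = 0)"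

text \<open>The right-hand side \<open>\<Sum>\<^sub>r y\<^sub>r log (1 - exp (- (\<kappa> y)\<^sub>r))\<close>,
  where terms with \<open>y\<^sub>r = 0\<close> count as 0.\<close>

definition conn_rate :: "real^'s^'s \<Rightarrow> real^'s::finite \<Rightarrow> ereal" where
  "conn_rate \<kappa> y = (\<Sum>r\<in>UNIV. if y $ r = 0 then 0
     else ereal (y $ r) * elog (1 - exp (- ((\<kappa> *v y) $ r))))"

section \<open>Well-definedness\<close>

lemma edge_val_doubleton:
  assumes "transpose A = A"
  shows "edge_val A x {i, j} = A $ x i $ x j"
proof -
  have "transpose A $ x i $ x j = A $ x i $ x j" by (simp only: assms)
  then have "A $ x j $ x i = A $ x i $ x j" by (simp add: transpose_def)
  then show ?thesis by (cases "i \<le> j") (simp_all add: edge_val_def min_def max_def)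
qed

lemma compatible_exists:
  fixes k :: "nat^'s::finite"
  shows "\<exists>x. compatible x k"
proof -
  define M where "M = (\<Sum>s\<in>UNIV. replicate_mset (k $ s) s)"
  obtain xs where xs: "mset xs = M" using ex_mset by blast
  have cnt: "count M s = k $ s" for s
    unfolding M_def count_sum by (simp add: sum.delta)
  have len: "length xs = total_count k"
    unfolding total_count_def size_mset[symmetric] xs M_def by (simp add: size_multiset_sum)
  have "card {i\<in>{1..total_count k}. xs ! (i - 1) = s} = k $ s" for s
  proof -
    have "Suc ` {i. i < length xs \<and> xs ! i = s} = {i\<in>{1..total_count k}. xs ! (i - 1) = s}"
      unfolding len[symmetric]
      by (auto simp: image_iff) (metis One_nat_def Suc_le_D Suc_le_lessD diff_Suc_1)
    then have "card {i\<in>{1..total_count k}. xs ! (i - 1) = s}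
        = card {i. i < length xs \<and> xs ! i = s}"
      using card_image[of Suc "{i. i < length xs \<and> xs ! i = s}"] by (simp only: inj_Suc)
    also have "\<dots> = length (filter ((=) s) xs)"
      by (simp add: length_filter_conv_card eq_commute[of s])
    also have "\<dots> = count (mset xs) s"
      by (simp add: count_mset count_list_eq_length_filter)
    finally show ?thesis using xs cnt by simp
  qed
  then have "compatible (\<lambda>i. xs ! (i - 1)) k" unfolding compatible_def by (rule allI)
  then show ?thesis by (rule exI[where x = "\<lambda>i. xs ! (i - 1)"])
qed

lemma compatible_relabel:
  assumes "compatible x k" "compatible x' k"
  obtains \<pi> where "bij_betw \<pi> {1..total_count k} {1..total_count k}"
    "\<And>i. i \<in> {1..total_count k} \<Longrightarrow> x (\<pi> i) = x' i"
proof -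
  let ?V = "{1..total_count k}"
  have "\<exists>h. bij_betw h {i\<in>?V. x' i = s} {i\<in>?V. x i = s}" for s
    using assms by (intro finite_same_card_bij) (auto simp: compatible_def)
  then obtain h where h: "\<And>s. bij_betw (h s) {i\<in>?V. x' i = s} {i\<in>?V. x i = s}"
    by metis
  define \<pi> where "\<pi> i = h (x' i) i" for i
  have mem: "\<pi> i \<in> ?V \<and> x (\<pi> i) = x' i" if "i \<in> ?V" for i
    using bij_betw_apply[OF h[of "x' i"], of i] that by (auto simp: \<pi>_def)
  have "inj_on \<pi> ?V"
  proof (rule inj_onI)
    fix i j assume ij: "i \<in> ?V" "j \<in> ?V" "\<pi> i = \<pi> j"
    then have "x' i = x' j" using mem by metis
    with ij show "i = j"
      using bij_betw_imp_inj_on[OF h[of "x' i"]] by (auto simp: \<pi>_def inj_on_def)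
  qed
  moreover have "\<pi> ` ?V \<subseteq> ?V" using mem by blast
  ultimately have "bij_betw \<pi> ?V ?V"
    by (simp add: bij_betw_def endo_inj_surj)
  with mem show ?thesis using that by blast
qed

lemma finite_vertex_pairs: "finite (vertex_pairs n)"
  unfolding vertex_pairs_def by (rule finite_subset[of _ "Pow {1..n}"]) auto

lemma pmf_random_graph:
  assumes "E \<subseteq> vertex_pairs n"
  shows "pmf (random_graph n x A) E =
    (\<Prod>e\<in>vertex_pairs n. pmf (bernoulli_pmf (min 1 (edge_val A x e))) (e \<in> E))"
proof -
  let ?P = "Pi_pmf (vertex_pairs n) False (\<lambda>e. bernoulli_pmf (min 1 (edge_val A x e)))"
  have sub: "set_pmf ?P \<subseteq> {f. \<forall>e. e \<notin> vertex_pairs n \<longrightarrow> f e = False}"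
    by (rule set_Pi_pmf_subset[OF finite_vertex_pairs])
  have "pmf (random_graph n x A) E
      = measure_pmf.prob ?P ((\<lambda>f. {e \<in> vertex_pairs n. f e}) -` {E})"
    unfolding random_graph_def by (simp add: pmf_map)
  also have "\<dots> = measure_pmf.prob ?P {\<lambda>e. e \<in> E}"
  proof (rule measure_pmf.finite_measure_eq_AE)
    show "AE f in ?P. f \<in> (\<lambda>f. {e \<in> vertex_pairs n. f e}) -` {E} \<longleftrightarrow> f \<in> {\<lambda>e. e \<in> E}"
      using sub assms by (intro AE_pmfI) (auto simp: fun_eq_iff)
  qed auto
  also have "\<dots> = pmf ?P (\<lambda>e. e \<in> E)" by (simp add: measure_pmf_single)
  also have "\<dots> = (\<Prod>e\<in>vertex_pairs n. pmf (bernoulli_pmf (min 1 (edge_val A x e))) (e \<in> E))"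
    using assms by (intro pmf_Pi'[OF finite_vertex_pairs]) auto
  finally show ?thesis .
qed

lemma prob_random_graph:
  "measure_pmf.prob (random_graph n x A) {E. graph_connected {1..n} E} =
    (\<Sum>E | E \<subseteq> vertex_pairs n \<and> graph_connected {1..n} E.
      \<Prod>e\<in>vertex_pairs n. pmf (bernoulli_pmf (min 1 (edge_val A x e))) (e \<in> E))"
proof -
  let ?G = "{E. E \<subseteq> vertex_pairs n \<and> graph_connected {1..n} E}"
  have fin: "finite ?G"
    using finite_vertex_pairs by (rule_tac finite_subset[of _ "Pow (vertex_pairs n)"]) auto
  have "set_pmf (random_graph n x A) \<subseteq> Pow (vertex_pairs n)"
    unfolding random_graph_def by auto
  then have "measure_pmf.prob (random_graph n x A) {E. graph_connected {1..n} E}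
      = measure_pmf.prob (random_graph n x A) ?G"
    by (intro measure_pmf.finite_measure_eq_AE AE_pmfI) auto
  also have "\<dots> = (\<Sum>E\<in>?G. pmf (random_graph n x A) E)"
    using fin by (simp add: measure_measure_pmf_finite)
  also have "\<dots> = (\<Sum>E\<in>?G. \<Prod>e\<in>vertex_pairs n.
      pmf (bernoulli_pmf (min 1 (edge_val A x e))) (e \<in> E))"
    by (intro sum.cong refl pmf_random_graph) auto
  finally show ?thesis .
qed

lemma graph_connected_image:
  assumes "graph_connected V E"
  shows "graph_connected (f ` V) ((`) f ` E)"
proof -
  have "(f u, f v) \<in> {(a, b). {a, b} \<in> (`) f ` E}\<^sup>*"
    if "(u, v) \<in> {(a, b). {a, b} \<in> E}\<^sup>*" for u v
    using that
  proof induction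
    case (step a b)
    then have "{f a, f b} \<in> (`) f ` E" by (auto intro!: image_eqI[of _ _ "{a, b}"])
    then have "(f a, f b) \<in> {(a, b). {a, b} \<in> (`) f ` E}" by simp
    with step.IH show ?case by (rule rtrancl_into_rtrancl)
  qed simp
  with assms show ?thesis unfolding graph_connected_def by blast
qed

lemma graph_cycle_image:
  assumes "graph_cycle E c" "inj_on f (\<Union>E)"
  shows "graph_cycle ((`) f ` E) (map f c)"
proof -
  have len: "3 \<le> length c" and dist: "distinct c"
    and edge: "\<And>i. i < length c \<Longrightarrow> {c ! i, c ! (Suc i mod length c)} \<in> E"
    using assms(1) by (auto simp: graph_cycle_def)
  have "v \<in> \<Union>E" if "v \<in> set c" for v
    using that edge by (metis UnionI in_set_conv_nth insertI1)
  then have "set c \<subseteq> \<Union>E" by blast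
  then have "distinct (map f c)"
    using dist assms(2) by (simp add: distinct_map inj_on_subset)
  moreover have "{f (c ! i), f (c ! (Suc i mod length c))} \<in> (`) f ` E" if "i < length c" for i
    using imageI[OF edge[OF that], of "(`) f"] by simp
  moreover have "Suc i mod length c < length c" for i
    using len by (intro mod_less_divisor) auto
  ultimately show ?thesis using len unfolding graph_cycle_def by simp
qed

lemma vertex_pairs_image:
  assumes "bij_betw \<pi> {1..n} {1..n}" "e \<in> vertex_pairs n"
  shows "\<pi> ` e \<in> vertex_pairs n"
  using assms unfolding vertex_pairs_def
  by (auto simp: card_image inj_on_subset bij_betw_def)

lemma image_image_inverse:
  assumes "\<And>i. i \<in> {1..n} \<Longrightarrow> g (f i) = i" "E \<subseteq> vertex_pairs n"
  shows "(`) g ` ((`) f ` E) = E"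
proof -
  have "g ` f ` e = e" if "e \<in> E" for e
  proof -
    have "e \<subseteq> {1..n}" using that assms(2) by (auto simp: vertex_pairs_def)
    then have "(\<lambda>i. g (f i)) ` e = id ` e" using assms(1) by (intro image_cong) auto
    then show ?thesis by (simp add: image_image)
  qed
  then have "(\<lambda>e. g ` f ` e) ` E = id ` E" by (intro image_cong) auto
  then show ?thesis by (simp add: image_image)
qed

lemma spanning_trees_image:
  assumes "bij_betw \<pi> {1..n} {1..n}" "T \<in> spanning_trees n"
  shows "(`) \<pi> ` T \<in> spanning_trees n"
proof -
  define \<rho> where "\<rho> = inv_into {1..n} \<pi>"
  have inv: "\<And>i. i \<in> {1..n} \<Longrightarrow> \<rho> (\<pi> i) = i" and \<rho>: "bij_betw \<rho> {1..n} {1..n}"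
    using assms(1) by (auto simp: \<rho>_def bij_betw_inv_into_left bij_betw_inv_into)
  have T: "T \<subseteq> vertex_pairs n" "graph_connected {1..n} T" "\<nexists>c. graph_cycle T c"
    using assms(2) by (auto simp: spanning_trees_def)
  have sub: "(`) \<pi> ` T \<subseteq> vertex_pairs n"
    using T(1) vertex_pairs_image[OF assms(1)] by blast
  have "graph_connected {1..n} ((`) \<pi> ` T)"
    using graph_connected_image[OF T(2), of \<pi>] assms(1) by (simp add: bij_betw_def)
  moreover have "\<nexists>c. graph_cycle ((`) \<pi> ` T) c"
  proof
    assume "\<exists>c. graph_cycle ((`) \<pi> ` T) c"
    then obtain c where c: "graph_cycle ((`) \<pi> ` T) c" ..
    have "\<Union>((`) \<pi> ` T) \<subseteq> {1..n}" using sub unfolding vertex_pairs_def by blast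
    then have "inj_on \<rho> (\<Union>((`) \<pi> ` T))"
      using \<rho> by (meson bij_betw_imp_inj_on inj_on_subset)
    from graph_cycle_image[OF c this] have "graph_cycle T (map \<rho> c)"
      using image_image_inverse[where g = \<rho> and f = \<pi> and n = n and E = T, OF inv T(1)] by simp
    with T(3) show False by blast
  qed
  ultimately show ?thesis using sub by (simp add: spanning_trees_def)
qed

lemma edge_val_relabel:
  assumes "transpose A = A" "e \<in> vertex_pairs n" "\<And>i. i \<in> {1..n} \<Longrightarrow> x (\<pi> i) = x' i"
  shows "edge_val A x (\<pi> ` e) = edge_val A x' e"
proof -
  obtain i j where "e = {i, j}" "i \<in> {1..n}" "j \<in> {1..n}"
    using assms(2) unfolding vertex_pairs_def by (auto simp: card_2_iff)
  then show ?thesis using assms(3) by (simp add: edge_val_doubleton[OF assms(1)])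
qed

theorem conn_prob_eq:
  assumes A: "transpose A = A" and k: "k \<noteq> 0" and x': "compatible x' k"
  shows "conn_prob A N k = measure_pmf.prob
    (random_graph (total_count k) x' ((1 / real N) *\<^sub>R A))
    {E. graph_connected {1..total_count k} E}"
proof -
  define n where "n = total_count k"
  define x where "x = (SOME x. compatible x k)"
  define B where "B = (1 / real N) *\<^sub>R A"
  have "compatible x k" unfolding x_def by (rule someI_ex[OF compatible_exists])
  then obtain \<pi> where \<pi>: "bij_betw \<pi> {1..n} {1..n}" "\<And>i. i \<in> {1..n} \<Longrightarrow> x (\<pi> i) = x' i"
    using compatible_relabel x' unfolding n_def by metis
  define \<rho> where "\<rho> = inv_into {1..n} \<pi>"
  have \<rho>: "bij_betw \<rho> {1..n} {1..n}" "\<And>i. i \<in> {1..n} \<Longrightarrow> \<rho> (\<pi> i) = i"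
    "\<And>i. i \<in> {1..n} \<Longrightarrow> \<pi> (\<rho> i) = i"
    using \<pi>(1) by (auto simp: \<rho>_def bij_betw_inv_into_left bij_betw_inv_into_right bij_betw_inv_into)
  have B: "transpose B = B"
    using A unfolding B_def by (simp add: transpose_def vec_eq_iff)
  have V: "\<pi> ` {1..n} = {1..n}" "\<rho> ` {1..n} = {1..n}"
    using \<pi>(1) \<rho>(1) by (auto simp: bij_betw_def)
  have ee: "\<rho> ` \<pi> ` e = e" "\<pi> ` \<rho> ` e = e" if "e \<in> vertex_pairs n" for e
  proof -
    have e: "{e} \<subseteq> vertex_pairs n" using that by simp
    show "\<rho> ` \<pi> ` e = e"
      using image_image_inverse[where g = \<rho> and f = \<pi> and n = n and E = "{e}", OF \<rho>(2) e] by simp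
    show "\<pi> ` \<rho> ` e = e"
      using image_image_inverse[where g = \<pi> and f = \<rho> and n = n and E = "{e}", OF \<rho>(3) e] by simp
  qed
  let ?w = "\<lambda>x E. \<Prod>e\<in>vertex_pairs n. pmf (bernoulli_pmf (min 1 (edge_val B x e))) (e \<in> E)"
  have w: "?w x ((`) \<pi> ` E) = ?w x' E" if E: "E \<subseteq> vertex_pairs n" for E
  proof (rule prod.reindex_bij_witness[of _ "(`) \<pi>" "(`) \<rho>"])
    fix e assume e: "e \<in> vertex_pairs n"
    have iff: "e \<in> (`) \<pi> ` E \<longleftrightarrow> \<rho> ` e \<in> E"
    proof
      assume "e \<in> (`) \<pi> ` E"
      then obtain e' where e': "e' \<in> E" "e = \<pi> ` e'" by (rule imageE)
      then show "\<rho> ` e \<in> E" using ee(1)[of e'] E by auto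
    next
      assume "\<rho> ` e \<in> E"
      then have "\<pi> ` \<rho> ` e \<in> (`) \<pi> ` E" by (rule imageI)
      then show "e \<in> (`) \<pi> ` E" by (simp only: ee(2)[OF e])
    qed
    show "\<rho> ` e \<in> vertex_pairs n" "\<pi> ` e \<in> vertex_pairs n"
      by (rule vertex_pairs_image[OF \<rho>(1) e] vertex_pairs_image[OF \<pi>(1) e])+
    show "\<pi> ` \<rho> ` e = e" "\<rho> ` \<pi> ` e = e" by (rule ee[OF e])+
    have "edge_val B x (\<pi> ` \<rho> ` e) = edge_val B x' (\<rho> ` e)"
      by (rule edge_val_relabel[where n = n, OF B vertex_pairs_image[OF \<rho>(1) e]]) (rule \<pi>(2))
    then show "pmf (bernoulli_pmf (min 1 (edge_val B x' (\<rho> ` e)))) (\<rho> ` e \<in> E) =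
        pmf (bernoulli_pmf (min 1 (edge_val B x e))) (e \<in> (`) \<pi> ` E)"
      by (simp only: ee(2)[OF e] iff)
  qed
  have "(\<Sum>E | E \<subseteq> vertex_pairs n \<and> graph_connected {1..n} E. ?w x' E)
      = (\<Sum>E | E \<subseteq> vertex_pairs n \<and> graph_connected {1..n} E. ?w x E)"
  proof (rule sum.reindex_bij_witness[of _ "(`) ((`) \<rho>)" "(`) ((`) \<pi>)"])
    fix E assume "E \<in> {E. E \<subseteq> vertex_pairs n \<and> graph_connected {1..n} E}"
    then have E: "E \<subseteq> vertex_pairs n" "graph_connected {1..n} E" by auto
    show "(`) \<rho> ` (`) \<pi> ` E = E" "(`) \<pi> ` (`) \<rho> ` E = E"
      using image_image_inverse[where g = \<rho> and f = \<pi> and n = n and E = E, OF \<rho>(2) E(1)]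
        image_image_inverse[where g = \<pi> and f = \<rho> and n = n and E = E, OF \<rho>(3) E(1)] by simp_all
    show "(`) \<pi> ` E \<in> {E. E \<subseteq> vertex_pairs n \<and> graph_connected {1..n} E}"
      using graph_connected_image[OF E(2), of \<pi>] V(1) vertex_pairs_image[OF \<pi>(1)] E(1) by auto
    show "(`) \<rho> ` E \<in> {E. E \<subseteq> vertex_pairs n \<and> graph_connected {1..n} E}"
      using graph_connected_image[OF E(2), of \<rho>] V(2) vertex_pairs_image[OF \<rho>(1)] E(1) by auto
    show "?w x ((`) \<pi> ` E) = ?w x' E" by (rule w[OF E(1)])
  qed
  with k show ?thesis
    unfolding conn_prob_def n_def[symmetric] x_def[symmetric] B_def[symmetric]
    by (simp only: prob_random_graph if_False)
qed

theorem tree_weight_eq: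
  assumes A: "transpose A = A" and k: "k \<noteq> 0" and x': "compatible x' k"
  shows "tree_weight A k = (\<Sum>T\<in>spanning_trees (total_count k). \<Prod>e\<in>T. edge_val A x' e)"
proof -
  define n where "n = total_count k"
  define x where "x = (SOME x. compatible x k)"
  have "compatible x k" unfolding x_def by (rule someI_ex[OF compatible_exists])
  then obtain \<pi> where \<pi>: "bij_betw \<pi> {1..n} {1..n}" "\<And>i. i \<in> {1..n} \<Longrightarrow> x (\<pi> i) = x' i"
    using compatible_relabel x' unfolding n_def by metis
  define \<rho> where "\<rho> = inv_into {1..n} \<pi>"
  have \<rho>: "bij_betw \<rho> {1..n} {1..n}" "\<And>i. i \<in> {1..n} \<Longrightarrow> \<rho> (\<pi> i) = i"
    "\<And>i. i \<in> {1..n} \<Longrightarrow> \<pi> (\<rho> i) = i"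
    using \<pi>(1) by (auto simp: \<rho>_def bij_betw_inv_into_left bij_betw_inv_into_right bij_betw_inv_into)
  have "(\<Sum>T\<in>spanning_trees n. \<Prod>e\<in>T. edge_val A x' e)
      = (\<Sum>T\<in>spanning_trees n. \<Prod>e\<in>T. edge_val A x e)"
  proof (rule sum.reindex_bij_witness[of _ "(`) ((`) \<rho>)" "(`) ((`) \<pi>)"])
    fix T assume T: "T \<in> spanning_trees n"
    then have sub: "T \<subseteq> vertex_pairs n" by (auto simp: spanning_trees_def)
    show "(`) \<rho> ` (`) \<pi> ` T = T" "(`) \<pi> ` (`) \<rho> ` T = T"
      using image_image_inverse[where g = \<rho> and f = \<pi> and n = n and E = T, OF \<rho>(2) sub]
        image_image_inverse[where g = \<pi> and f = \<rho> and n = n and E = T, OF \<rho>(3) sub] by simp_all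
    show "(`) \<pi> ` T \<in> spanning_trees n" "(`) \<rho> ` T \<in> spanning_trees n"
      using spanning_trees_image T \<pi>(1) \<rho>(1) by auto
    have "inj_on ((`) \<pi>) T"
    proof (rule inj_onI)
      fix e e' assume "e \<in> T" "e' \<in> T" "\<pi> ` e = \<pi> ` e'"
      moreover from this sub have "e \<subseteq> {1..n}" "e' \<subseteq> {1..n}" by (auto simp: vertex_pairs_def)
      ultimately show "e = e'"
        using \<pi>(1) by (meson bij_betw_imp_inj_on inj_on_image_eq_iff)
    qed
    then have "(\<Prod>e\<in>(`) \<pi> ` T. edge_val A x e) = (\<Prod>e\<in>T. edge_val A x (\<pi> ` e))"
      by (simp add: prod.reindex)
    also have "\<dots> = (\<Prod>e\<in>T. edge_val A x' e)"
      using sub \<pi>(2) by (intro prod.cong refl edge_val_relabel[OF A, where n = n]) auto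
    finally show "(\<Prod>e\<in>(`) \<pi> ` T. edge_val A x e) = (\<Prod>e\<in>T. edge_val A x' e)" .
  qed
  with k show ?thesis
    unfolding tree_weight_def n_def[symmetric] x_def[symmetric] by simp
qed

end

theory Submission
  imports Defs
begin

text \<open>Connectivity of the undirected random graph has the same probability as the event that a
  fixed root reaches every vertex in the digraph in which both arcs of every pair are present
  independently. Necessarily every vertex other than the root then has an incoming arc, and these
  events are independent; this is the upper bound.

  For the lower bound let \<open>R(A)\<close> be the probability that a set \<open>A\<close> of roots reaches every
  vertex, let \<open>v \<notin> A\<close>, and let \<open>q(v)\<close> be the probability that \<open>v\<close> has an incoming arc. If
  \<open>A \<union> {v}\<close> reaches everything and \<open>v\<close> has an in-neighbour \<open>u\<close>, then \<open>A\<close> can fail to reach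
  everything only if \<open>u\<close> is reached exclusively from \<open>v\<close>; if \<open>A\<close> contains \<open>i\<close> vertices of the
  type of \<open>v\<close>, this has conditional probability at most \<open>1 / (i + 1)\<close> by exchangeability. Hence
  \<open>R(A) \<ge> q(v) (i / (i + 1)) R(A \<union> {v})\<close>. As \<open>A\<close> grows from one representative of each type to
  the whole vertex set, the factors \<open>i / (i + 1)\<close> telescope to \<open>1 / \<Prod>\<^sub>r k\<^sub>r\<close>. Connecting the
  representatives, possible because \<open>\<tau>(k) > 0\<close>, costs at most a power of \<open>1 / N\<close>, and neither
  factor matters on the exponential scale.\<close>

section \<open>Expectations over random subsets\<close>

text \<open>The expectation of \<open>h\<close> over a random subset of \<open>I\<close> that
  contains each \<open>i\<close> independently with probability \<open>p i\<close>, as a finite sum.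
  Independence thereby becomes algebra valid for all real \<open>p\<close>; monotonicity asks for
  values in the unit interval.\<close>

definition bern_exp :: "'i set \<Rightarrow> ('i \<Rightarrow> real) \<Rightarrow> ('i set \<Rightarrow> real) \<Rightarrow> real" where
  "bern_exp I p h = (\<Sum>S\<in>Pow I. (\<Prod>i\<in>I. if i \<in> S then p i else 1 - p i) * h S)"

lemma bern_exp_empty [simp]: "bern_exp {} p h = h {}"
  by (simp add: bern_exp_def)

text \<open>Conditioning on the coordinate \<open>i\<close>; the recursion behind the inductions on
  the index set.\<close>

lemma bern_exp_insert:
  assumes "finite I" "i \<notin> I"
  shows "bern_exp (insert i I) p h
    = p i * bern_exp I p (\<lambda>S. h (insert i S)) + (1 - p i) * bern_exp I p h"
proof -
  let ?w = "\<lambda>I S. \<Prod>j\<in>I. if j \<in> S then p j else 1 - p j"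
  have disj: "Pow I \<inter> insert i ` Pow I = {}" using assms(2) by auto
  have inj: "inj_on (insert i) (Pow I)" using assms(2) by (auto simp: inj_on_def insert_eq_iff)
  have w1: "?w (insert i I) (insert i S) = p i * ?w I S" for S
  proof -
    have "?w I (insert i S) = ?w I S" using assms(2) by (intro prod.cong) auto
    then show ?thesis using assms by simp
  qed
  have w2: "?w (insert i I) S = (1 - p i) * ?w I S" if "S \<in> Pow I" for S
    using assms that by (subst prod.insert) auto
  have "bern_exp (insert i I) p h = (\<Sum>S\<in>Pow I. ?w (insert i I) S * h S)
      + (\<Sum>S\<in>insert i ` Pow I. ?w (insert i I) S * h S)"
    unfolding bern_exp_def Pow_insert
    using assms(1) disj by (intro sum.union_disjoint) auto
  also have "(\<Sum>S\<in>insert i ` Pow I. ?w (insert i I) S * h S)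
      = (\<Sum>S\<in>Pow I. ?w (insert i I) (insert i S) * h (insert i S))"
    by (simp only: sum.reindex[OF inj] o_def)
  also have "\<dots> = p i * bern_exp I p (\<lambda>S. h (insert i S))"
    unfolding bern_exp_def w1 by (simp add: sum_distrib_left mult.assoc)
  also have "(\<Sum>S\<in>Pow I. ?w (insert i I) S * h S) = (1 - p i) * bern_exp I p h"
    unfolding bern_exp_def sum_distrib_left by (intro sum.cong refl) (simp only: w2 mult.assoc)
  finally show ?thesis by simp
qed

lemma bern_exp_cong:
  assumes "\<And>i. i \<in> I \<Longrightarrow> p i = p' i" "\<And>S. S \<subseteq> I \<Longrightarrow> h S = h' S"
  shows "bern_exp I p h = bern_exp I p' h'"
  unfolding bern_exp_def
proof (intro sum.cong refl arg_cong2[where f = "(*)"] prod.cong)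
  fix S i
  assume "S \<in> Pow I" "i \<in> I"
  then show "(if i \<in> S then p i else 1 - p i) = (if i \<in> S then p' i else 1 - p' i)"
    by (simp add: assms(1))
qed (simp add: assms(2))

lemma bern_exp_mono:
  assumes "\<And>i. i \<in> I \<Longrightarrow> p i \<in> {0..1}" "\<And>S. S \<subseteq> I \<Longrightarrow> h S \<le> h' S"
  shows "bern_exp I p h \<le> bern_exp I p h'"
  unfolding bern_exp_def using assms by (intro sum_mono mult_left_mono prod_nonneg) auto

lemma bern_exp_cmult: "bern_exp I p (\<lambda>S. c * h S) = c * bern_exp I p h"
  unfolding bern_exp_def by (simp add: sum_distrib_left mult_ac)

lemma bern_exp_diff: "bern_exp I p (\<lambda>S. h S - h' S) = bern_exp I p h - bern_exp I p h'"
  unfolding bern_exp_def by (simp add: sum_subtractf right_diff_distrib)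

lemma bern_exp_sum: "bern_exp I p (\<lambda>S. \<Sum>x\<in>X. h x S) = (\<Sum>x\<in>X. bern_exp I p (h x))"
  unfolding bern_exp_def sum_distrib_left by (rule sum.swap)

lemma bern_exp_const:
  assumes "finite I"
  shows "bern_exp I p (\<lambda>_. c) = c"
  using assms by (induction I rule: finite_induct) (simp_all add: bern_exp_insert algebra_simps)

text \<open>Fubini for the independent coordinates in \<open>I\<close> and \<open>J\<close>.\<close>

lemma bern_exp_Un:
  assumes "finite I" "finite J" "I \<inter> J = {}"
  shows "bern_exp (I \<union> J) p h = bern_exp I p (\<lambda>S. bern_exp J p (\<lambda>T. h (S \<union> T)))"
  using assms(1,3)
proof (induction I arbitrary: h rule: finite_induct)
  case (insert i I)
  then show ?case using assms(2) by (simp add: bern_exp_insert)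
qed simp

text \<open>Relabelling of coordinates; for a relabelling of \<open>I\<close> onto itself that
  preserves \<open>p\<close> this is exchangeability.\<close>

lemma bern_exp_image:
  assumes "finite I" "inj_on f I"
  shows "bern_exp (f ` I) p h = bern_exp I (p \<circ> f) (\<lambda>S. h (f ` S))"
  using assms
proof (induction I arbitrary: h rule: finite_induct)
  case (insert i I)
  then have "f i \<notin> f ` I" by (auto simp: inj_on_def)
  with insert show ?case by (simp add: bern_exp_insert)
qed simp

lemma bern_exp_mem:
  assumes "finite I" "i \<in> I"
  shows "bern_exp I p (\<lambda>S. of_bool (i \<in> S)) = p i"
proof -
  have "bern_exp (insert i (I - {i})) p (\<lambda>S. of_bool (i \<in> S)) = p i * bern_exp (I - {i}) p (\<lambda>S. 1)
      + (1 - p i) * bern_exp (I - {i}) p (\<lambda>S. 0)"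
    using assms(1) bern_exp_cong[of "I - {i}" p p "\<lambda>S. of_bool (i \<in> S)" "\<lambda>S. 0"]
    by (subst bern_exp_insert) auto
  then show ?thesis using assms by (simp add: bern_exp_const insert_absorb)
qed

lemma bern_exp_nonempty:
  assumes "finite I"
  shows "bern_exp I p (\<lambda>S. of_bool (S \<noteq> {})) = 1 - (\<Prod>i\<in>I. 1 - p i)"
  using assms
proof (induction I rule: finite_induct)
  case (insert i I)
  then show ?case by (simp add: bern_exp_insert bern_exp_const) (simp add: algebra_simps)
qed simp

section \<open>Undirected connectivity and directed reachability\<close>

definition arcs_of :: "'v set set \<Rightarrow> ('v \<times> 'v) set" where
  "arcs_of E = {(a, b). {a, b} \<in> E}"

text \<open>An arc is idle if its tail is not reached or its head is reached already.\<close>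

lemma reach_insert:
  assumes "u \<notin> S\<^sup>* `` A \<or> v \<in> S\<^sup>* `` A"
  shows "(insert (u, v) S)\<^sup>* `` A = S\<^sup>* `` A"
proof -
  have "y \<in> S\<^sup>* `` A" if "a \<in> A" "(a, u) \<in> S\<^sup>*" "(v, y) \<in> S\<^sup>*" for a y
  proof -
    have "v \<in> S\<^sup>* `` A" using assms that(1,2) by blast
    then show ?thesis using that(3) by (meson Image_iff rtrancl_trans)
  qed
  then show ?thesis unfolding rtrancl_insert by blast
qed

lemma reach_mono: "S \<subseteq> T \<Longrightarrow> S\<^sup>* `` A \<subseteq> T\<^sup>* `` A"
  by (meson Image_mono order_refl rtrancl_mono)

text \<open>At most one of the two arcs between \<open>u\<close> and \<open>v\<close> can enlarge the reachable set.\<close>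

lemma reach_modular:
  fixes Q :: "'v set \<Rightarrow> real"
  shows "Q ((insert (u, v) (insert (v, u) S))\<^sup>* `` A) + Q (S\<^sup>* `` A)
    = Q ((insert (u, v) S)\<^sup>* `` A) + Q ((insert (v, u) S)\<^sup>* `` A)"
proof (cases "u \<notin> S\<^sup>* `` A \<or> v \<in> S\<^sup>* `` A")
  case True
  \<comment> \<open>\<open>(u, v)\<close> is idle over \<open>S\<close>. It stays idle after
    \<open>(v, u)\<close> is added: if \<open>v\<close> is not reached over \<open>S\<close>, then
    \<open>(v, u)\<close> changes nothing.\<close>
  have "u \<notin> (insert (v, u) S)\<^sup>* `` A \<or> v \<in> (insert (v, u) S)\<^sup>* `` A"
  proof (cases "v \<in> S\<^sup>* `` A")
    case True
    then show ?thesis using reach_mono[of S "insert (v, u) S" A] by auto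
  next
    case False
    then have "(insert (v, u) S)\<^sup>* `` A = S\<^sup>* `` A" by (intro reach_insert) simp
    with True False show ?thesis by simp
  qed
  then show ?thesis using True by (simp only: reach_insert)
next
  case False
  \<comment> \<open>Here \<open>u\<close> is reached and \<open>v\<close> is not, so
    \<open>(v, u)\<close> is the idle arc, both before and after \<open>(u, v)\<close> is
    added.\<close>
  then have u: "v \<notin> S\<^sup>* `` A \<or> u \<in> S\<^sup>* `` A" by auto
  have "u \<in> (insert (u, v) S)\<^sup>* `` A"
    using False reach_mono[of S "insert (u, v) S" A] by auto
  then have "(insert (v, u) (insert (u, v) S))\<^sup>* `` A = (insert (u, v) S)\<^sup>* `` A"
    by (intro reach_insert) simp
  then show ?thesis using reach_insert[OF u] by (simp add: insert_commute)
qed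

text \<open>For one pair of probability \<open>p\<close>, independent arcs give weight
  \<open>p^2\<close> to both arcs, \<open>p (1 - p)\<close> to each single arc and
  \<open>(1 - p)^2\<close> to none. The modular identity trades the two single-arc values for those
  of both and none, which leaves the weights \<open>p\<close> and \<open>1 - p\<close> of an
  undirected edge. Finiteness of the arc set is carried along for
  \<open>bern_exp_insert\<close>.\<close>

lemma bern_exp_undirected_eq_directed:
  fixes h :: "('v \<times> 'v) set \<Rightarrow> real"
  assumes "finite Q" "\<And>e. e \<in> Q \<Longrightarrow> card e = 2"
    and "\<And>S u v. h (insert (u, v) (insert (v, u) S)) + h S = h (insert (u, v) S) + h (insert (v, u) S)"
  shows "bern_exp Q p (\<lambda>E. h (arcs_of E)) = bern_exp (arcs_of Q) (\<lambda>(u, v). p {u, v}) h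
    \<and> finite (arcs_of Q)"
  using assms
proof (induction Q arbitrary: h rule: finite_induct)
  case empty
  then show ?case by (simp add: arcs_of_def)
next
  case (insert e Q)
  then obtain u v where e: "e = {u, v}" "u \<noteq> v" by (metis card_2_iff insertI1)
  let ?q = "\<lambda>(u, v). p {u, v}"
  have arcs: "arcs_of (insert e E) = insert (u, v) (insert (v, u) (arcs_of E))" for E
    unfolding arcs_of_def e by (auto simp: doubleton_eq_iff)
  have new: "(u, v) \<notin> insert (v, u) (arcs_of Q)" "(v, u) \<notin> arcs_of Q"
    using insert.hyps(2) e by (auto simp: arcs_of_def insert_commute)
  have fin: "finite (arcs_of Q)"
    using insert.IH[of "\<lambda>_. 0"] insert.prems(1) by simp
  have IH: "bern_exp Q p (\<lambda>E. h (arcs_of E)) = bern_exp (arcs_of Q) ?q h"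
    using insert.IH[of h] insert.prems by simp
  \<comment> \<open>Adding both arcs to the argument of \<open>h\<close> preserves the modular
    identity, so the induction hypothesis applies to the shifted function.\<close>
  have "bern_exp Q p (\<lambda>E. h (insert (u, v) (insert (v, u) (arcs_of E))))
      = bern_exp (arcs_of Q) ?q (\<lambda>S. h (insert (u, v) (insert (v, u) S)))"
    using insert.prems(1) insert.prems(2)[where S = "insert (u, v) (insert (v, u) S)" for S]
    by (intro insert.IH[THEN conjunct1]) (auto simp: insert_commute)
  moreover have "bern_exp (arcs_of Q) ?q h = bern_exp (arcs_of Q) ?q (\<lambda>S. h (insert (u, v) S))
      + bern_exp (arcs_of Q) ?q (\<lambda>S. h (insert (v, u) S))
      - bern_exp (arcs_of Q) ?q (\<lambda>S. h (insert (u, v) (insert (v, u) S)))"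
  proof -
    have "bern_exp (arcs_of Q) ?q h
      = bern_exp (arcs_of Q) ?q (\<lambda>S. h (insert (u, v) S) - (h (insert (u, v) (insert (v, u) S))
         - h (insert (v, u) S)))"
      using insert.prems(2)[of u v] by (intro bern_exp_cong) (auto simp: algebra_simps)
    then show ?thesis by (simp add: bern_exp_diff)
  qed
  moreover have "p {v, u} = p e" "p {u, v} = p e" by (simp_all add: e(1) insert_commute)
  ultimately show ?case
    using insert.hyps fin new IH
    by (simp add: arcs bern_exp_insert insert_commute) (simp add: algebra_simps)
qed

text \<open>Arcs come in both directions, so reachability is symmetric and any two vertices are
  joined via \<open>r\<close>.\<close>

lemma graph_connected_iff_reach:
  assumes "r \<in> V"
  shows "graph_connected V E \<longleftrightarrow> V \<subseteq> (arcs_of E)\<^sup>* `` {r}"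
proof -
  have "sym (arcs_of E)" by (auto simp: sym_def arcs_of_def insert_commute)
  then have "sym ((arcs_of E)\<^sup>*)" by (rule sym_rtrancl)
  then have "(u, v) \<in> (arcs_of E)\<^sup>*"
    if "(r, u) \<in> (arcs_of E)\<^sup>*" "(r, v) \<in> (arcs_of E)\<^sup>*" for u v
    using that by (meson rtrancl_trans symD)
  then have *: "(u, v) \<in> (arcs_of E)\<^sup>*" if "V \<subseteq> (arcs_of E)\<^sup>* `` {r}" "u \<in> V" "v \<in> V" for u v
    using that by blast
  show ?thesis
    unfolding graph_connected_def arcs_of_def[symmetric] using assms * by (intro iffI) blast+
qed

definition all_arcs :: "'v set \<Rightarrow> ('v \<times> 'v) set" where
  "all_arcs V = {(u, v). u \<in> V \<and> v \<in> V \<and> u \<noteq> v}"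

lemma arcs_of_vertex_pairs: "arcs_of (vertex_pairs n) = all_arcs {1..n}"
  unfolding arcs_of_def vertex_pairs_def all_arcs_def by (auto simp: card_2_iff doubleton_eq_iff)

text \<open>This is \<open>R(A)\<close> of the overview, for independent arcs with individual
  probabilities \<open>p\<close>.\<close>

definition reach_prob :: "'v set \<Rightarrow> ('v \<times> 'v \<Rightarrow> real) \<Rightarrow> 'v set \<Rightarrow> real" where
  "reach_prob V p A = bern_exp (all_arcs V) p (\<lambda>S. of_bool (V \<subseteq> S\<^sup>* `` A))"

text \<open>The event depends on the arcs only through the reachable set of \<open>r\<close>, so
  \<open>reach_modular\<close> permits decoupling the two arcs of every pair.\<close>

theorem prob_connected_eq_reach_prob:
  assumes A: "transpose A = A" "\<And>r s. A $ r $ s \<ge> 0" and r: "r \<in> {1..n}"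
  shows "measure_pmf.prob (random_graph n x A) {E. graph_connected {1..n} E}
    = reach_prob {1..n} (\<lambda>(u, v). min 1 (A $ x u $ x v)) {r}"
proof -
  let ?p = "\<lambda>e. min 1 (edge_val A x e)"
  let ?V = "{1..n}"
  have "measure_pmf.prob (random_graph n x A) {E. graph_connected ?V E}
      = (\<Sum>E\<in>Pow (vertex_pairs n). (\<Prod>e\<in>vertex_pairs n. pmf (bernoulli_pmf (?p e)) (e \<in> E))
          * of_bool (graph_connected ?V E))"
    unfolding prob_random_graph using finite_vertex_pairs
    by (intro sum.mono_neutral_cong_left) auto
  also have "\<dots> = bern_exp (vertex_pairs n) ?p (\<lambda>E. of_bool (graph_connected ?V E))"
  proof -
    \<comment> \<open>Nonnegativity of \<open>A\<close> enters here, because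
      \<open>bernoulli_pmf\<close> clamps its parameter to the unit interval.\<close>
    have "pmf (bernoulli_pmf (?p e)) b = (if b then ?p e else 1 - ?p e)" for b e
      using A(2) by (cases b) (auto simp: edge_val_def)
    then show ?thesis unfolding bern_exp_def by simp
  qed
  also have "\<dots> = bern_exp (vertex_pairs n) ?p (\<lambda>E. of_bool (?V \<subseteq> (arcs_of E)\<^sup>* `` {r}))"
    by (simp only: graph_connected_iff_reach[OF r])
  also have "\<dots> = bern_exp (arcs_of (vertex_pairs n)) (\<lambda>(u, v). ?p {u, v})
      (\<lambda>S. of_bool (?V \<subseteq> S\<^sup>* `` {r}))"
    using finite_vertex_pairs reach_modular[of "\<lambda>R. of_bool (?V \<subseteq> R)"]
    by (intro bern_exp_undirected_eq_directed[THEN conjunct1]) (auto simp: vertex_pairs_def)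
  finally show ?thesis
    by (simp add: reach_prob_def arcs_of_vertex_pairs edge_val_doubleton[OF A(1)])
qed

section \<open>Upper bound: independence of the in-neighbourhoods\<close>

lemma bern_exp_restrict:
  assumes "finite D" "I \<subseteq> D"
  shows "bern_exp D p (\<lambda>S. h (S \<inter> I)) = bern_exp I p h"
proof -
  have "bern_exp (I \<union> (D - I)) p (\<lambda>S. h (S \<inter> I))
      = bern_exp I p (\<lambda>S. bern_exp (D - I) p (\<lambda>T. h ((S \<union> T) \<inter> I)))"
    using assms by (intro bern_exp_Un) (auto intro: finite_subset)
  also have "\<dots> = bern_exp I p (\<lambda>S. bern_exp (D - I) p (\<lambda>T. h S))"
    by (intro bern_exp_cong refl arg_cong[where f = h]) auto
  also have "\<dots> = bern_exp I p h"
    using assms(1) by (simp add: bern_exp_const)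
  finally show ?thesis using assms(2) by (simp add: Un_absorb1)
qed

lemma bern_exp_prod:
  fixes f :: "'k \<Rightarrow> 'i set \<Rightarrow> real"
  assumes "finite W" "\<And>v. v \<in> W \<Longrightarrow> finite (J v)"
    and "\<And>v w. v \<in> W \<Longrightarrow> w \<in> W \<Longrightarrow> v \<noteq> w \<Longrightarrow> J v \<inter> J w = {}"
  shows "bern_exp (\<Union>v\<in>W. J v) p (\<lambda>S. \<Prod>v\<in>W. f v (S \<inter> J v)) = (\<Prod>v\<in>W. bern_exp (J v) p (f v))"
  using assms
proof (induction W rule: finite_induct)
  case (insert v W)
  have disj: "J v \<inter> (\<Union>w\<in>W. J w) = {}" using insert.prems(2)[of v] insert.hyps(2) by auto
  let ?U = "\<Union>w\<in>W. J w"
  have "bern_exp (J v \<union> ?U) p (\<lambda>S. \<Prod>w\<in>insert v W. f w (S \<inter> J w))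
      = bern_exp (J v) p (\<lambda>S. bern_exp ?U p (\<lambda>T. \<Prod>w\<in>insert v W. f w ((S \<union> T) \<inter> J w)))"
    using insert.hyps(1) insert.prems(1) disj by (intro bern_exp_Un) auto
  also have "\<dots> = bern_exp (J v) p (\<lambda>S. bern_exp ?U p (\<lambda>T. f v S * (\<Prod>w\<in>W. f w (T \<inter> J w))))"
  proof (intro bern_exp_cong refl)
    fix S T
    assume ST: "S \<subseteq> J v" "T \<subseteq> ?U"
    then have "(S \<union> T) \<inter> J v = S" using disj by auto
    moreover have "(S \<union> T) \<inter> J w = T \<inter> J w" if "w \<in> W" for w
      using ST(1) disj that by auto
    ultimately show "(\<Prod>w\<in>insert v W. f w ((S \<union> T) \<inter> J w)) = f v S * (\<Prod>w\<in>W. f w (T \<inter> J w))"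
      using insert.hyps by simp
  qed
  also have "\<dots> = bern_exp (J v) p (f v) * bern_exp ?U p (\<lambda>T. \<Prod>w\<in>W. f w (T \<inter> J w))"
    unfolding bern_exp_cmult by (simp add: mult.commute[of "f v S" for S] bern_exp_cmult)
  also have "bern_exp ?U p (\<lambda>T. \<Prod>w\<in>W. f w (T \<inter> J w)) = (\<Prod>v\<in>W. bern_exp (J v) p (f v))"
    using insert.prems by (intro insert.IH) auto
  finally show ?case using insert.hyps by simp
qed simp

text \<open>Arcs are grouped by head, so that the blocks of different heads are disjoint and hence
  independent.\<close>

definition arcs_into :: "'v set \<Rightarrow> 'v set \<Rightarrow> ('v \<times> 'v) set" where
  "arcs_into V W = {(u, v) \<in> all_arcs V. v \<in> W}"

lemma all_arcs_eq_arcs_into: "all_arcs V = arcs_into V V"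
  by (auto simp: arcs_into_def all_arcs_def)

lemma finite_arcs_into: "finite V \<Longrightarrow> finite (arcs_into V W)"
  by (rule finite_subset[of _ "V \<times> V"]) (auto simp: arcs_into_def all_arcs_def)

text \<open>This is \<open>q(v)\<close> of the overview.\<close>

definition indeg_prob :: "'v set \<Rightarrow> ('v \<times> 'v \<Rightarrow> real) \<Rightarrow> 'v \<Rightarrow> real" where
  "indeg_prob V p v = 1 - (\<Prod>u\<in>V - {v}. 1 - p (u, v))"

lemma bern_exp_arcs_into_nonempty:
  assumes "finite V" "v \<in> V"
  shows "bern_exp (arcs_into V {v}) p (\<lambda>S. of_bool (S \<noteq> {})) = indeg_prob V p v"
proof -
  have eq: "arcs_into V {v} = (\<lambda>u. (u, v)) ` (V - {v})"
    using assms(2) by (auto simp: arcs_into_def all_arcs_def)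
  have "inj_on (\<lambda>u. (u, v)) (V - {v})" by (auto simp: inj_on_def)
  then show ?thesis
    unfolding indeg_prob_def bern_exp_nonempty[OF finite_arcs_into[OF assms(1)]] unfolding eq
    by (simp add: prod.reindex)
qed

lemma indeg_prob_bounds:
  assumes "\<And>i. p i \<in> {0..1}"
  shows "indeg_prob V p v \<in> {0..1}"
proof -
  have "(\<Prod>u\<in>V - {v}. 1 - p (u, v)) \<in> {0..1}"
    using assms by (auto intro!: prod_nonneg prod_le_1)
  then show ?thesis by (auto simp: indeg_prob_def)
qed

lemma indeg_prob_ge:
  assumes "\<And>i. p i \<in> {0..1}" "finite V" "u \<in> V" "u \<noteq> v"
  shows "p (u, v) \<le> indeg_prob V p v"
proof -
  have "(\<Prod>w\<in>V - {v}. 1 - p (w, v)) = (1 - p (u, v)) * (\<Prod>w\<in>V - {v} - {u}. 1 - p (w, v))"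
    using assms by (intro prod.remove) auto
  also have "\<dots> \<le> (1 - p (u, v)) * 1"
    using assms(1) by (intro mult_left_mono prod_le_1) auto
  finally show ?thesis by (simp add: indeg_prob_def)
qed

text \<open>If the root reaches every vertex, each other vertex has an incoming arc.\<close>

theorem reach_prob_le:
  assumes "finite V" "\<And>i. p i \<in> {0..1}" "r \<in> V"
  shows "reach_prob V p {r} \<le> (\<Prod>v\<in>V - {r}. indeg_prob V p v)"
proof -
  let ?J = "\<lambda>v. arcs_into V {v}"
  \<comment> \<open>The factor of the root is constantly 1, so that the product can run over all
    blocks of \<open>all_arcs V\<close>.\<close>
  let ?f = "\<lambda>v S. of_bool (v = r \<or> S \<noteq> {}) :: real"
  have all: "all_arcs V = (\<Union>v\<in>V. ?J v)" by (auto simp: arcs_into_def all_arcs_def)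
  have "reach_prob V p {r} \<le> bern_exp (all_arcs V) p (\<lambda>S. \<Prod>v\<in>V. ?f v (S \<inter> ?J v))"
    unfolding reach_prob_def
  proof (intro bern_exp_mono)
    fix S assume S: "S \<subseteq> all_arcs V"
    have *: "S \<inter> ?J v \<noteq> {}" if reach: "V \<subseteq> S\<^sup>* `` {r}" and v: "v \<in> V" "v \<noteq> r" for v
    proof -
      have "(r, v) \<in> S\<^sup>*" using reach v by auto
      then obtain u where "(u, v) \<in> S" using v(2) by (auto elim: rtranclE)
      then show ?thesis using S by (auto simp: arcs_into_def)
    qed
    show "of_bool (V \<subseteq> S\<^sup>* `` {r}) \<le> (\<Prod>v\<in>V. ?f v (S \<inter> ?J v))"
    proof (cases "V \<subseteq> S\<^sup>* `` {r}")
      case True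
      then have "(\<Prod>v\<in>V. ?f v (S \<inter> ?J v)) = 1"
        using * by (intro prod.neutral) auto
      then show ?thesis by simp
    qed (simp add: prod_nonneg)
  qed (rule assms(2))
  also have "\<dots> = (\<Prod>v\<in>V. bern_exp (?J v) p (?f v))"
    unfolding all using assms(1)
    by (intro bern_exp_prod finite_arcs_into) (auto simp: arcs_into_def)
  also have "\<dots> = (\<Prod>v\<in>V - {r}. bern_exp (?J v) p (?f v))"
    using assms(1) by (intro prod.mono_neutral_right) (auto simp: bern_exp_const finite_arcs_into)
  also have "\<dots> = (\<Prod>v\<in>V - {r}. indeg_prob V p v)"
    using assms(1) by (intro prod.cong refl) (auto simp: bern_exp_arcs_into_nonempty)
  finally show ?thesis .
qed

section \<open>Lower bound: adding one root at a time\<close>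

text \<open>A path from \<open>B\<close> can be started afresh whenever it returns to
  \<open>B\<close>, so arcs with head in \<open>B\<close> contribute nothing.\<close>

lemma reach_avoid: "S\<^sup>* `` B = (S \<inter> {(u, v). v \<notin> B})\<^sup>* `` B"
proof
  show "(S \<inter> {(u, v). v \<notin> B})\<^sup>* `` B \<subseteq> S\<^sup>* `` B" by (intro reach_mono) auto
  show "S\<^sup>* `` B \<subseteq> (S \<inter> {(u, v). v \<notin> B})\<^sup>* `` B"
  proof
    fix y assume "y \<in> S\<^sup>* `` B"
    then obtain b where "b \<in> B" "(b, y) \<in> S\<^sup>*" by auto
    from this(2,1) show "y \<in> (S \<inter> {(u, v). v \<notin> B})\<^sup>* `` B"
    proof (induction rule: rtrancl_induct)
      case (step y z)
      show ?case
      proof (cases "z \<in> B")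
        case False
        with step.hyps(2) have "(y, z) \<in> S \<inter> {(u, v). v \<notin> B}" by simp
        with step.IH step.prems show ?thesis by (auto intro: rtrancl_into_rtrancl)
      qed auto
    qed auto
  qed
qed

text \<open>For \<open>B = insert v A\<close> this leaves an expectation over arcs that do not enter
  \<open>v\<close>, which is independent of the arcs into \<open>v\<close>.\<close>

lemma reach_prob_avoid:
  assumes "finite V"
  shows "reach_prob V p B = bern_exp (arcs_into V (V - B)) p (\<lambda>S. of_bool (V \<subseteq> S\<^sup>* `` B))"
proof -
  have "reach_prob V p B
      = bern_exp (all_arcs V) p (\<lambda>S. of_bool (V \<subseteq> (S \<inter> arcs_into V (V - B))\<^sup>* `` B))"
    unfolding reach_prob_def
  proof (intro bern_exp_cong refl)
    fix S assume "S \<subseteq> all_arcs V"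
    then have "S \<inter> arcs_into V (V - B) = S \<inter> {(u, v). v \<notin> B}"
      by (auto simp: arcs_into_def all_arcs_def)
    then show "of_bool (V \<subseteq> S\<^sup>* `` B) = of_bool (V \<subseteq> (S \<inter> arcs_into V (V - B))\<^sup>* `` B)"
      using reach_avoid[of S B] by simp
  qed
  also have "\<dots> = bern_exp (arcs_into V (V - B)) p (\<lambda>S. of_bool (V \<subseteq> S\<^sup>* `` B))"
    unfolding all_arcs_eq_arcs_into
    by (intro bern_exp_restrict finite_arcs_into assms) (auto simp: arcs_into_def)
  finally show ?thesis .
qed

text \<open>\<open>T\<close> collects the arcs into \<open>v\<close> and \<open>S\<close> those into
  the non-roots; the two are independent. If an in-neighbour of \<open>v\<close> is reached from
  \<open>A\<close>, then so is \<open>v\<close>, and with it everything that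
  \<open>insert v A\<close> reaches.\<close>

lemma reach_prob_ge_conditional:
  assumes V: "finite V" and p: "\<And>i. p i \<in> {0..1}" and A: "v \<in> V" "v \<notin> A"
  shows "bern_exp (arcs_into V {v}) p (\<lambda>T. bern_exp (arcs_into V (V - insert v A)) p
      (\<lambda>S. of_bool (V \<subseteq> S\<^sup>* `` insert v A \<and> (\<exists>u. (u, v) \<in> T \<and> u \<in> S\<^sup>* `` A))))
    \<le> reach_prob V p A" (is "bern_exp ?J p (\<lambda>T. bern_exp ?D p (\<lambda>S. ?h S T)) \<le> _")
proof -
  have J: "T \<inter> ?J = T" "S \<inter> ?J = {}" "T \<inter> ?D = {}" "S \<inter> ?D = S" if "T \<subseteq> ?J" "S \<subseteq> ?D" for T S
    using that by (auto simp: arcs_into_def)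
  have "bern_exp ?J p (\<lambda>T. bern_exp ?D p (\<lambda>S. ?h S T))
      = bern_exp ?J p (\<lambda>T. bern_exp ?D p (\<lambda>S. ?h ((T \<union> S) \<inter> ?D) ((T \<union> S) \<inter> ?J)))"
    by (intro bern_exp_cong refl) (simp add: J Int_Un_distrib2)
  also have "\<dots> = bern_exp (?J \<union> ?D) p (\<lambda>S. ?h (S \<inter> ?D) (S \<inter> ?J))"
    using V by (intro bern_exp_Un[symmetric] finite_arcs_into) (auto simp: arcs_into_def)
  also have "\<dots> = bern_exp (all_arcs V) p (\<lambda>S. ?h (S \<inter> (?J \<union> ?D) \<inter> ?D) (S \<inter> (?J \<union> ?D) \<inter> ?J))"
    unfolding all_arcs_eq_arcs_into using A(1)
    by (intro bern_exp_restrict[symmetric] finite_arcs_into V) (auto simp: arcs_into_def)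
  also have "\<dots> \<le> reach_prob V p A"
    unfolding reach_prob_def
  proof (intro bern_exp_mono)
    fix S assume "S \<subseteq> all_arcs V"
    have "V \<subseteq> S\<^sup>* `` A"
      if E: "V \<subseteq> (S \<inter> (?J \<union> ?D) \<inter> ?D)\<^sup>* `` insert v A"
        and u: "(u, v) \<in> S \<inter> (?J \<union> ?D) \<inter> ?J" "u \<in> (S \<inter> (?J \<union> ?D) \<inter> ?D)\<^sup>* `` A" for u
    proof -
      have "u \<in> S\<^sup>* `` A"
        using u(2) reach_mono[of "S \<inter> (?J \<union> ?D) \<inter> ?D" S A] by blast
      then obtain a where a: "a \<in> A" "(a, u) \<in> S\<^sup>*" by blast
      have v: "(a, v) \<in> S\<^sup>*" using a(2) u(1) by (auto intro: rtrancl_into_rtrancl)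
      have "S\<^sup>* `` insert v A \<subseteq> S\<^sup>* `` A" using a(1) v by (auto intro: rtrancl_trans)
      moreover have "V \<subseteq> S\<^sup>* `` insert v A"
        using E reach_mono[of "S \<inter> (?J \<union> ?D) \<inter> ?D" S "insert v A"] by blast
      ultimately show ?thesis by blast
    qed
    then show "?h (S \<inter> (?J \<union> ?D) \<inter> ?D) (S \<inter> (?J \<union> ?D) \<inter> ?J) \<le> of_bool (V \<subseteq> S\<^sup>* `` A)"
      by auto
  qed (use p in auto)
  finally show ?thesis .
qed

lemma reach_prob_nonneg:
  assumes "\<And>i. p i \<in> {0..1}"
  shows "reach_prob V p A \<ge> 0"
proof -
  show ?thesis unfolding reach_prob_def bern_exp_def
    using assms by (intro sum_nonneg mult_nonneg_nonneg prod_nonneg) auto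
qed

text \<open>The in-neighbour of \<open>v\<close> is taken to be the root \<open>a\<close>, which is
  reached trivially. This is how representatives of different types get connected.\<close>

lemma reach_prob_insert_edge:
  assumes V: "finite V" and p: "\<And>i. p i \<in> {0..1}" and A: "A \<subseteq> V" "v \<in> V" "v \<notin> A"
    and a: "a \<in> A"
  shows "p (a, v) * reach_prob V p (insert v A) \<le> reach_prob V p A"
proof -
  let ?J = "arcs_into V {v}" and ?D = "arcs_into V (V - insert v A)"
  let ?R = "reach_prob V p (insert v A)"
  have "(a, v) \<in> ?J" using A a by (auto simp: arcs_into_def all_arcs_def)
  then have "p (a, v) * ?R = bern_exp ?J p (\<lambda>T. of_bool ((a, v) \<in> T) * ?R)"
    by (simp add: mult.commute[of _ ?R] bern_exp_cmult bern_exp_mem finite_arcs_into[OF V])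
  also have "\<dots> \<le> bern_exp ?J p (\<lambda>T. bern_exp ?D p
      (\<lambda>S. of_bool (V \<subseteq> S\<^sup>* `` insert v A \<and> (\<exists>u. (u, v) \<in> T \<and> u \<in> S\<^sup>* `` A))))"
  proof (intro bern_exp_mono p)
    fix T
    show "of_bool ((a, v) \<in> T) * ?R \<le> bern_exp ?D p
      (\<lambda>S. of_bool (V \<subseteq> S\<^sup>* `` insert v A \<and> (\<exists>u. (u, v) \<in> T \<and> u \<in> S\<^sup>* `` A)))"
      unfolding reach_prob_avoid[OF V] bern_exp_cmult[symmetric] using a
      by (intro bern_exp_mono p) auto
  qed
  also have "\<dots> \<le> reach_prob V p A"
    using V p A(2,3) by (rule reach_prob_ge_conditional)
  finally show ?thesis .
qed

lemma reach_image:
  assumes "inj f"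
  shows "(map_prod f f ` S)\<^sup>* `` (f ` X) = f ` (S\<^sup>* `` X)"
proof (intro equalityI subsetI)
  fix y assume "y \<in> (map_prod f f ` S)\<^sup>* `` (f ` X)"
  then obtain x where x: "x \<in> X" "(f x, y) \<in> (map_prod f f ` S)\<^sup>*" by auto
  from x(2) show "y \<in> f ` (S\<^sup>* `` X)"
  proof (induction rule: rtrancl_induct)
    case base
    then show ?case using x(1) by auto
  next
    case (step y z)
    then obtain w where w: "w \<in> S\<^sup>* `` X" "y = f w" by auto
    with step.hyps(2) obtain w' where "(w, w') \<in> S" "z = f w'"
      using assms by (auto simp: inj_eq)
    with w(1) show ?case by (auto intro: rtrancl_into_rtrancl)
  qed
next
  fix y assume "y \<in> f ` (S\<^sup>* `` X)"
  then obtain x z where x: "x \<in> X" "(x, z) \<in> S\<^sup>*" "y = f z" by auto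
  from x(2) have "(f x, f z) \<in> (map_prod f f ` S)\<^sup>*"
  proof (induction rule: rtrancl_induct)
    case (step y z)
    then have "(f y, f z) \<in> map_prod f f ` S" by force
    with step.IH show ?case by (rule rtrancl_into_rtrancl)
  qed auto
  then show "y \<in> (map_prod f f ` S)\<^sup>* `` (f ` X)" using x by auto
qed

text \<open>By exchangeability, each of the \<open>card C + 1\<close> mutually exclusive events that \<open>u\<close> is
  reached from exactly one root \<open>a \<in> insert v C\<close> and from no other root has the same
  probability.\<close>

lemma only_reached_from_le:
  assumes V: "finite V" and p: "\<And>i. p i \<in> {0..1}" and A: "A \<subseteq> V" "v \<in> V" "v \<notin> A"
    and C: "C \<subseteq> A"
    and exch: "\<And>a u w. a \<in> C \<Longrightarrow> p (Transposition.transpose a v u, Transposition.transpose a v w) = p (u, w)"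
    and u: "u \<in> V" "u \<noteq> v"
  shows "real (card C + 1) * bern_exp (arcs_into V (V - insert v A)) p
      (\<lambda>S. of_bool (V \<subseteq> S\<^sup>* `` insert v A \<and> u \<notin> S\<^sup>* `` A)) \<le> reach_prob V p (insert v A)"
proof (cases "u \<in> A")
  case True
  have "bern_exp (arcs_into V (V - insert v A)) p
      (\<lambda>S. of_bool (V \<subseteq> S\<^sup>* `` insert v A \<and> u \<notin> S\<^sup>* `` A))
      = bern_exp (arcs_into V (V - insert v A)) p (\<lambda>S. 0)"
    using True by (intro bern_exp_cong) auto
  then show ?thesis
    using V reach_prob_nonneg[OF p] by (simp add: bern_exp_const finite_arcs_into)
next
  case False
  let ?B = "insert v A"
  let ?D = "arcs_into V (V - ?B)"
  \<comment> \<open>In the event \<open>?h a\<close>, everything is reached, but \<open>u\<close>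
    from no root other than \<open>a\<close>. Since \<open>?B - {v} = A\<close>, the claim concerns
    \<open>?h v\<close>.\<close>
  let ?h = "\<lambda>a S. of_bool (V \<subseteq> S\<^sup>* `` ?B \<and> u \<notin> S\<^sup>* `` (?B - {a})) :: real"
  have finD: "finite ?D" using V by (rule finite_arcs_into)
  have eq: "bern_exp ?D p (?h a) = bern_exp ?D p (?h v)" if a: "a \<in> C" for a
  proof -
    \<comment> \<open>Swapping \<open>a\<close> and \<open>v\<close> preserves the vertices, the
      roots and \<open>p\<close>, and it fixes \<open>u\<close>, which is neither in
      \<open>A\<close> nor equal to \<open>v\<close>.\<close>
    define \<sigma> where "\<sigma> = Transposition.transpose a v"
    let ?f = "map_prod \<sigma> \<sigma>"
    have inj: "inj \<sigma>" and inv: "\<sigma> (\<sigma> w) = w" for w by (simp_all add: \<sigma>_def)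
    have aB: "a \<in> A" "a \<in> V" "a \<noteq> v" using a C A by auto
    have B: "\<sigma> ` ?B = ?B" "\<sigma> ` V = V" "\<sigma> ` (?B - {v}) = ?B - {a}" and \<sigma>u: "\<sigma> u = u"
      using aB A u False by (auto simp: \<sigma>_def Transposition.transpose_def image_iff)
    have mem: "\<sigma> w \<in> V \<longleftrightarrow> w \<in> V" "\<sigma> w \<in> ?B \<longleftrightarrow> w \<in> ?B" for w
      using aB A by (auto simp: \<sigma>_def Transposition.transpose_def)
    have D_sub: "?f ` ?D \<subseteq> ?D"
      using mem inj by (auto simp: arcs_into_def all_arcs_def inj_eq simp del: insert_iff)
    have "?f ` ?D = ?D"
    proof
      show "?D \<subseteq> ?f ` ?D"
      proof
        fix i assume "i \<in> ?D"
        then have "?f i \<in> ?D" using D_sub by blast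
        moreover have "i = ?f (?f i)" by (cases i) (simp add: inv)
        ultimately show "i \<in> ?f ` ?D" by (rule rev_image_eqI)
      qed
    qed (rule D_sub)
    then have "bern_exp ?D p (?h a) = bern_exp (?f ` ?D) p (?h a)" by simp
    also have "\<dots> = bern_exp ?D (p \<circ> ?f) (\<lambda>S. ?h a (?f ` S))"
      using inj finD by (intro bern_exp_image inj_on_subset[OF prod.inj_map]) auto
    also have "\<dots> = bern_exp ?D p (?h v)"
    proof (intro bern_exp_cong)
      fix i show "(p \<circ> ?f) i = p i"
        using exch[OF a] by (cases i) (simp add: \<sigma>_def)
    next
      fix S
      have "(?f ` S)\<^sup>* `` ?B = \<sigma> ` (S\<^sup>* `` ?B)"
        "(?f ` S)\<^sup>* `` (?B - {a}) = \<sigma> ` (S\<^sup>* `` (?B - {v}))"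
        using reach_image[OF inj, of S ?B] reach_image[OF inj, of S "?B - {v}"] B by simp_all
      moreover have "V \<subseteq> \<sigma> ` X \<longleftrightarrow> V \<subseteq> X" for X
        using inj B(2) by (metis inj_image_subset_iff)
      moreover have "u \<in> \<sigma> ` X \<longleftrightarrow> u \<in> X" for X
        using inj \<sigma>u by (metis inj_image_mem_iff)
      ultimately show "?h a (?f ` S) = ?h v S" by simp
    qed
    finally show ?thesis .
  qed
  have finC: "finite C" using C A(1) V by (auto intro: finite_subset)
  have vC: "v \<notin> C" using C A(3) by auto
  have "real (card C + 1) * bern_exp ?D p (?h v) = (\<Sum>a\<in>insert v C. bern_exp ?D p (?h v))"
    using finC vC by simp
  also have "\<dots> = (\<Sum>a\<in>insert v C. bern_exp ?D p (?h a))"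
    using eq by (intro sum.cong) auto
  also have "\<dots> = bern_exp ?D p (\<lambda>S. \<Sum>a\<in>insert v C. ?h a S)"
    by (rule bern_exp_sum[symmetric])
  also have "\<dots> \<le> bern_exp ?D p (\<lambda>S. of_bool (V \<subseteq> S\<^sup>* `` ?B))"
  proof (intro bern_exp_mono p)
    fix S
    show "(\<Sum>a\<in>insert v C. ?h a S) \<le> of_bool (V \<subseteq> S\<^sup>* `` ?B)"
    proof (cases "V \<subseteq> S\<^sup>* `` ?B")
      case True
      \<comment> \<open>Some root \<open>b\<close> reaches \<open>u\<close>, so
        \<open>?h a S\<close> can hold for \<open>a = b\<close> only.\<close>
      then obtain b where b: "b \<in> ?B" "u \<in> S\<^sup>* `` {b}" using u by blast
      have "?h a S = 0" if "a \<noteq> b" for a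
        using b that by auto
      then have "(\<Sum>a\<in>insert v C. ?h a S) \<le> (\<Sum>a\<in>insert v C. if a = b then 1 else 0)"
        by (intro sum_mono) auto
      also have "\<dots> \<le> 1" using finC by simp
      finally show ?thesis using True by simp
    qed auto
  qed
  also have "\<dots> = reach_prob V p ?B" by (rule reach_prob_avoid[OF V, symmetric])
  finally show ?thesis using A(3) by simp
qed

text \<open>With the arcs \<open>T\<close> into \<open>v\<close> fixed, one in-neighbour
  \<open>u\<close> suffices: by \<open>only_reached_from_le\<close> the loss is at most
  \<open>?R / (card C + 1)\<close>, uniformly in nonempty \<open>T\<close>.\<close>

lemma reach_prob_insert_exchangeable:
  assumes V: "finite V" and p: "\<And>i. p i \<in> {0..1}" and A: "A \<subseteq> V" "v \<in> V" "v \<notin> A"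
    and C: "C \<subseteq> A"
    and exch: "\<And>a u w. a \<in> C \<Longrightarrow> p (Transposition.transpose a v u, Transposition.transpose a v w) = p (u, w)"
  shows "indeg_prob V p v * (real (card C) / real (card C + 1)) * reach_prob V p (insert v A)
    \<le> reach_prob V p A"
proof -
  let ?J = "arcs_into V {v}" and ?D = "arcs_into V (V - insert v A)"
  let ?R = "reach_prob V p (insert v A)"
  let ?c = "real (card C) / real (card C + 1) * ?R"
  let ?E = "\<lambda>S. V \<subseteq> S\<^sup>* `` insert v A"
  have "indeg_prob V p v * ?c = bern_exp ?J p (\<lambda>T. ?c * of_bool (T \<noteq> {}))"
    unfolding bern_exp_cmult using V A(2) by (simp add: bern_exp_arcs_into_nonempty)
  also have "\<dots> \<le> bern_exp ?J p (\<lambda>T. bern_exp ?D p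
      (\<lambda>S. of_bool (?E S \<and> (\<exists>u. (u, v) \<in> T \<and> u \<in> S\<^sup>* `` A))))"
  proof (intro bern_exp_mono p)
    fix T assume T: "T \<subseteq> ?J"
    show "?c * of_bool (T \<noteq> {}) \<le> bern_exp ?D p
      (\<lambda>S. of_bool (?E S \<and> (\<exists>u. (u, v) \<in> T \<and> u \<in> S\<^sup>* `` A)))"
    proof (cases "T = {}")
      case True
      then show ?thesis using V by (simp add: bern_exp_const finite_arcs_into)
    next
      case False
      then obtain u where u: "(u, v) \<in> T" using T by (auto simp: arcs_into_def)
      then have uV: "u \<in> V" "u \<noteq> v" using T by (auto simp: arcs_into_def all_arcs_def)
      have "real (card C + 1) * bern_exp ?D p (\<lambda>S. of_bool (?E S \<and> u \<notin> S\<^sup>* `` A)) \<le> ?R"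
        using V p A C exch uV by (rule only_reached_from_le)
      then have "bern_exp ?D p (\<lambda>S. of_bool (?E S \<and> u \<notin> S\<^sup>* `` A)) \<le> ?R / real (card C + 1)"
        by (simp add: pos_le_divide_eq mult.commute)
      moreover have "?c = ?R - ?R / real (card C + 1)" by (simp add: field_simps)
      ultimately have "?c \<le> ?R - bern_exp ?D p (\<lambda>S. of_bool (?E S \<and> u \<notin> S\<^sup>* `` A))" by simp
      also have "\<dots> = bern_exp ?D p (\<lambda>S. of_bool (?E S) - of_bool (?E S \<and> u \<notin> S\<^sup>* `` A))"
        unfolding reach_prob_avoid[OF V] bern_exp_diff ..
      also have "\<dots> \<le> bern_exp ?D p
          (\<lambda>S. of_bool (?E S \<and> (\<exists>u. (u, v) \<in> T \<and> u \<in> S\<^sup>* `` A)))"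
        using u by (intro bern_exp_mono p) auto
      finally show ?thesis using False by simp
    qed
  qed
  also have "\<dots> \<le> reach_prob V p A"
    using V p A(2,3) by (rule reach_prob_ge_conditional)
  finally show ?thesis by (simp add: mult.assoc)
qed

section \<open>Bounds in terms of types\<close>

text \<open>Strong induction on the number of non-roots, down to \<open>A = V\<close>, where the
  reach probability is 1. The quotient of the counts of type \<open>r\<close> in \<open>A\<close>
  and in \<open>V\<close> is the telescoped product of the factors
  \<open>i / (i + 1)\<close>.\<close>

lemma reach_prob_ge_prod:
  fixes x :: "'v \<Rightarrow> 's"
  assumes V: "finite V" and \<pi>: "\<And>r s. \<pi> r s \<in> {0..1}"
    and A: "A \<subseteq> V" "\<And>v. v \<in> V \<Longrightarrow> \<exists>a\<in>A. x a = x v"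
  defines "p \<equiv> \<lambda>(u, v). \<pi> (x u) (x v) :: real"
  shows "(\<Prod>v\<in>V - A. indeg_prob V p v)
      * (\<Prod>r\<in>x ` V. real (card {a\<in>A. x a = r}) / real (card {a\<in>V. x a = r})) \<le> reach_prob V p A"
  using A
proof (induction "card (V - A)" arbitrary: A rule: less_induct)
  case (less A)
  have p: "p i \<in> {0..1}" for i using \<pi> by (auto simp: p_def split: prod.split)
  let ?n = "\<lambda>A r. real (card {a\<in>A. x a = r})"
  have pos: "?n V r > 0" if "r \<in> x ` V" for r
    using V that by (auto simp: card_gt_0_iff)
  show ?case
  proof (cases "A = V")
    case True
    have "reach_prob V p V = bern_exp (all_arcs V) p (\<lambda>_. 1)"
      unfolding reach_prob_def by (intro bern_exp_cong) auto
    also have "\<dots> = 1"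
      using V by (simp add: bern_exp_const all_arcs_eq_arcs_into finite_arcs_into)
    also have "(\<Prod>r\<in>x ` V. ?n V r / ?n V r) = 1"
      using pos by (intro prod.neutral) force
    ultimately show ?thesis using True by simp
  next
    case False
    then obtain v where v: "v \<in> V" "v \<notin> A" using less.prems(1) by auto
    let ?B = "insert v A"
    define C where "C = {a\<in>A. x a = x v}"
    have finA: "finite A" using less.prems(1) V by (rule finite_subset)
    have C: "C \<subseteq> A" "finite C" using finA by (auto simp: C_def)
    have B: "V - A = insert v (V - ?B)" using v by auto
    have "(\<Prod>w\<in>V - ?B. indeg_prob V p w) * (\<Prod>r\<in>x ` V. ?n ?B r / ?n V r) \<le> reach_prob V p ?B"
    proof (rule less.hyps)
      show "card (V - ?B) < card (V - A)" unfolding B using V by simp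
      show "?B \<subseteq> V" using v less.prems(1) by simp
      show "\<exists>a\<in>?B. x a = x w" if "w \<in> V" for w using less.prems(2)[OF that] by auto
    qed
    \<comment> \<open>Adding \<open>v\<close> changes the count of its own type only, from
      \<open>card C\<close> to \<open>card C + 1\<close>.\<close>
    moreover have "(\<Prod>r\<in>x ` V. ?n A r / ?n V r)
        = real (card C) / real (card C + 1) * (\<Prod>r\<in>x ` V. ?n ?B r / ?n V r)"
    proof -
      have "{a\<in>?B. x a = x v} = insert v C" by (auto simp: C_def)
      moreover have "v \<notin> C" using v(2) by (simp add: C_def)
      ultimately have nB: "?n ?B (x v) = real (card C + 1)" using C(2) by simp
      have "{a\<in>?B. x a = r} = {a\<in>A. x a = r}" if "r \<noteq> x v" for r using that by auto
      then have rest: "(\<Prod>r\<in>x ` V - {x v}. ?n ?B r / ?n V r) = (\<Prod>r\<in>x ` V - {x v}. ?n A r / ?n V r)"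
        by (intro prod.cong) auto
      have rem: "(\<Prod>r\<in>x ` V. ?n X r / ?n V r)
          = ?n X (x v) / ?n V (x v) * (\<Prod>r\<in>x ` V - {x v}. ?n X r / ?n V r)" for X
        using V v(1) by (intro prod.remove) auto
      show ?thesis unfolding rem[of A] rem[of ?B] rest nB by (simp add: C_def)
    qed
    moreover have "indeg_prob V p v * (real (card C) / real (card C + 1)) * reach_prob V p ?B
        \<le> reach_prob V p A"
    proof (rule reach_prob_insert_exchangeable[OF V p less.prems(1) v C(1)])
      fix a u w assume "a \<in> C"
      then have "x (Transposition.transpose a v z) = x z" for z
        by (auto simp: C_def Transposition.transpose_def)
      then show "p (Transposition.transpose a v u, Transposition.transpose a v w) = p (u, w)"
        by (simp add: p_def)
    qed
    moreover have "0 \<le> indeg_prob V p v * (real (card C) / real (card C + 1))"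
      using indeg_prob_bounds[of p V v] p by simp
    ultimately have "indeg_prob V p v * (real (card C) / real (card C + 1))
        * ((\<Prod>w\<in>V - ?B. indeg_prob V p w) * (\<Prod>r\<in>x ` V. ?n ?B r / ?n V r)) \<le> reach_prob V p A"
      by (meson mult_left_mono order_trans)
    moreover have "(\<Prod>w\<in>V - A. indeg_prob V p w)
        = indeg_prob V p v * (\<Prod>w\<in>V - ?B. indeg_prob V p w)"
      unfolding B using V by (subst prod.insert) auto
    ultimately show ?thesis
      using \<open>(\<Prod>r\<in>x ` V. ?n A r / ?n V r) = _\<close> by (simp only: mult_ac)
  qed
qed

text \<open>The root set grows towards \<open>B\<close> one vertex at a time, each time along an arc
  of probability at least \<open>c\<close> that leaves the current set.\<close>

lemma reach_prob_ge_subset: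
  assumes V: "finite V" and p: "\<And>i. p i \<in> {0..1}" and c: "0 \<le> c" and B: "B \<subseteq> V"
    and cross: "\<And>C. C \<subset> B \<Longrightarrow> C \<noteq> {} \<Longrightarrow> \<exists>u\<in>C. \<exists>v\<in>B - C. c \<le> p (u, v)"
    and A: "A \<subseteq> B" "A \<noteq> {}"
  shows "c ^ card (B - A) * reach_prob V p B \<le> reach_prob V p A"
  using A
proof (induction "card (B - A)" arbitrary: A)
  case 0
  then have "A = B" using finite_subset[OF B V] by auto
  then show ?case by simp
next
  case (Suc n)
  then have "A \<subset> B" by auto
  from cross[OF this Suc.prems(2)] obtain u v where uv: "u \<in> A" "v \<in> B - A" "c \<le> p (u, v)"
    by blast
  have BA: "B - A = insert v (B - insert v A)" using uv by auto
  have fin: "finite (B - insert v A)" using finite_subset[OF B V] by simp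
  have "card (B - A) = Suc (card (B - insert v A))"
    using fin by (subst BA) (rule card_insert_disjoint, auto)
  then have n: "n = card (B - insert v A)" using Suc.hyps(2) by simp
  have "c ^ n * reach_prob V p B \<le> reach_prob V p (insert v A)"
    unfolding n using Suc.prems uv by (intro Suc.hyps(1)[OF n]) auto
  then have "c * (c ^ n * reach_prob V p B) \<le> p (u, v) * reach_prob V p (insert v A)"
    using c uv(3) p by (intro mult_mono) (auto intro!: mult_nonneg_nonneg reach_prob_nonneg)
  also have "\<dots> \<le> reach_prob V p A"
    using uv Suc.prems B by (intro reach_prob_insert_edge V p) auto
  finally show ?case by (simp add: Suc.hyps(2)[symmetric] mult.assoc)
qed

lemma prod_by_type:
  fixes x :: "'v \<Rightarrow> 's::finite" and f :: "'s \<Rightarrow> real"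
  assumes "finite W"
  shows "(\<Prod>v\<in>W. f (x v)) = (\<Prod>r\<in>UNIV. f r ^ card {v\<in>W. x v = r})"
proof -
  have "(\<Prod>v\<in>W. f (x v)) = (\<Prod>r\<in>UNIV. \<Prod>v\<in>{v\<in>W. x v = r}. f (x v))"
    using assms by (intro prod.group[symmetric]) auto
  also have "\<dots> = (\<Prod>r\<in>UNIV. \<Prod>v\<in>{v\<in>W. x v = r}. f r)"
    by (intro prod.cong) auto
  finally show ?thesis by simp
qed

text \<open>The value of \<open>indeg_prob\<close> at a vertex of type \<open>r\<close>, in terms of
  the type counts \<open>k\<close>; subtracting \<open>of_bool (s = r)\<close> leaves out the vertex
  itself.\<close>

definition type_indeg_prob :: "('s::finite \<Rightarrow> 's \<Rightarrow> real) \<Rightarrow> ('s \<Rightarrow> nat) \<Rightarrow> 's \<Rightarrow> real" where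
  "type_indeg_prob \<pi> k r = 1 - (\<Prod>s\<in>UNIV. (1 - \<pi> s r) ^ (k s - of_bool (s = r)))"

lemma type_indeg_prob_bounds:
  assumes "\<And>r s. \<pi> r s \<in> {0..1}"
  shows "type_indeg_prob \<pi> k r \<in> {0..1}"
proof -
  have "(\<Prod>s\<in>UNIV. (1 - \<pi> s r) ^ (k s - of_bool (s = r))) \<in> {0..1}"
    using assms by (auto intro!: prod_nonneg prod_le_1 power_le_one)
  then show ?thesis by (auto simp: type_indeg_prob_def)
qed

lemma card_type_Diff_one:
  assumes "finite V" "v \<in> V"
  shows "card {u\<in>V - {v}. x u = r} = card {u\<in>V. x u = r} - of_bool (r = x v)"
proof -
  have "{u\<in>V - {v}. x u = r} = {u\<in>V. x u = r} - (if r = x v then {v} else {})" by auto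
  then show ?thesis using assms by (simp add: card_Diff_singleton)
qed

lemma indeg_prob_eq_type:
  fixes x :: "'v \<Rightarrow> 's::finite"
  assumes "finite V" "v \<in> V" "\<And>s. k s = card {u\<in>V. x u = s}"
  shows "indeg_prob V (\<lambda>(u, v). \<pi> (x u) (x v)) v = type_indeg_prob \<pi> k (x v)"
  using assms(1) prod_by_type[of "V - {v}" "\<lambda>s. 1 - \<pi> s (x v)" x]
  by (simp only: indeg_prob_def type_indeg_prob_def prod.case card_type_Diff_one[OF assms(1,2)] assms(3)
      finite_Diff)

text \<open>All factors are at most 1, so the product can only grow when every exponent is lowered
  to \<open>k r - 1\<close>, whatever the type of the root, and the types outside \<open>U\<close>
  are dropped. The application has \<open>U = supp y\<close>.\<close>

theorem reach_prob_le_types: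
  fixes x :: "'v \<Rightarrow> 's::finite"
  assumes V: "finite V" and \<pi>: "\<And>r s. \<pi> r s \<in> {0..1}" and v: "v \<in> V"
    and k_def: "\<And>s. k s = card {u\<in>V. x u = s}"
  shows "reach_prob V (\<lambda>(u, v). \<pi> (x u) (x v)) {v}
    \<le> (\<Prod>r\<in>U. type_indeg_prob \<pi> k r ^ (k r - 1))"
proof -
  let ?p = "\<lambda>(u, v). \<pi> (x u) (x v)" and ?q = "type_indeg_prob \<pi> k"
  have p: "?p i \<in> {0..1}" for i using \<pi> by (auto split: prod.split)
  have q: "0 \<le> ?q r" "?q r \<le> 1" for r
    using type_indeg_prob_bounds[of \<pi>, OF \<pi>, where k = k and r = r] by auto
  have "reach_prob V ?p {v} \<le> (\<Prod>w\<in>V - {v}. indeg_prob V ?p w)"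
    using V p v by (rule reach_prob_le)
  also have "\<dots> = (\<Prod>w\<in>V - {v}. ?q (x w))"
    using V by (intro prod.cong) (auto intro: indeg_prob_eq_type k_def)
  also have "\<dots> = (\<Prod>r\<in>UNIV. ?q r ^ (k r - of_bool (r = x v)))"
    unfolding k_def card_type_Diff_one[OF V v, symmetric] using V by (intro prod_by_type) simp
  also have "\<dots> = (\<Prod>r\<in>U. ?q r ^ (k r - of_bool (r = x v))) * (\<Prod>r\<in>-U. ?q r ^ (k r - of_bool (r = x v)))"
    by (subst prod.union_disjoint[symmetric]) (auto intro: arg_cong[where f = "prod _"])
  also have "\<dots> \<le> (\<Prod>r\<in>U. ?q r ^ (k r - 1)) * 1"
    using q by (intro mult_mono prod_mono prod_le_1 prod_nonneg conjI power_decreasing power_le_one)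
      auto
  finally show ?thesis by simp
qed

text \<open>\<open>A\<close> holds one representative of each occurring type. Growing
  \<open>A\<close> to \<open>V\<close> accounts for the product over types; growing a single
  representative to \<open>A\<close> costs at most one factor \<open>c\<close> per type.\<close>

theorem reach_prob_ge_types:
  fixes x :: "'v \<Rightarrow> 's::finite"
  assumes V: "finite V" "V \<noteq> {}" and \<pi>: "\<And>r s. \<pi> r s \<in> {0..1}" and c: "0 \<le> c" "c \<le> 1"
    and cross: "\<And>C. C \<subset> V \<Longrightarrow> C \<noteq> {} \<Longrightarrow> \<exists>u\<in>C. \<exists>v\<in>V - C. c \<le> \<pi> (x u) (x v)"
    and k_def: "\<And>s. k s = card {u\<in>V. x u = s}"
  obtains v where "v \<in> V"
    "c ^ CARD('s) * (\<Prod>r | k r > 0. type_indeg_prob \<pi> k r ^ (k r - 1) / real (k r))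
      \<le> reach_prob V (\<lambda>(u, v). \<pi> (x u) (x v)) {v}"
proof -
  let ?p = "\<lambda>(u, v). \<pi> (x u) (x v)" and ?q = "type_indeg_prob \<pi> k"
  have p: "?p i \<in> {0..1}" for i using \<pi> by (auto split: prod.split)
  have q: "0 \<le> ?q r" "?q r \<le> 1" for r
    using type_indeg_prob_bounds[of \<pi>, OF \<pi>, where k = k and r = r] by auto
  have K: "{r. k r > 0} = x ` V" using V(1) by (auto simp: k_def card_gt_0_iff)
  define \<rho> where "\<rho> = inv_into V x"
  define A where "A = \<rho> ` x ` V"
  have \<rho>: "\<rho> r \<in> V" "x (\<rho> r) = r" if "r \<in> x ` V" for r
    using that by (auto simp: \<rho>_def inv_into_into f_inv_into_f)
  have AV: "A \<subseteq> V" using \<rho> by (auto simp: A_def)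
  have injA: "a = b" if "a \<in> A" "b \<in> A" "x a = x b" for a b
    using that \<rho>(2) by (auto simp: A_def)
  have A_type: "{a\<in>A. x a = r} = {\<rho> r}" if "r \<in> x ` V" for r
    using \<rho>(2) that by (auto simp: A_def)
  have "card A \<le> card (x ` V)" unfolding A_def using V(1) by (intro card_image_le) simp
  also have "\<dots> \<le> CARD('s)" by (rule card_mono) auto
  finally have card_A: "card (A - {a}) \<le> CARD('s)" for a
    using card_Diff1_le[of A a] by simp
  obtain v where v: "v \<in> A" using V(2) by (auto simp: A_def)
  \<comment> \<open>The crossing hypothesis passes to representatives: enlarge \<open>C\<close> to
    all vertices whose type occurs in it, take a crossing pair there, and replace both ends by
    elements of \<open>A\<close> of the same types.\<close>
  have crossA: "\<exists>u\<in>C. \<exists>w\<in>A - C. c \<le> ?p (u, w)" if C: "C \<subset> A" "C \<noteq> {}" for C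
  proof -
    let ?C = "{w\<in>V. x w \<in> x ` C}"
    obtain a where a: "a \<in> A" "a \<notin> C" using C by auto
    have "x a \<notin> x ` C" using injA a C(1) by (metis imageE psubsetD)
    then have "?C \<subset> V" using a(1) AV by auto
    moreover have "?C \<noteq> {}" using C AV by auto
    ultimately obtain u w where uw: "u \<in> ?C" "w \<in> V - ?C" "c \<le> \<pi> (x u) (x w)"
      using cross[of ?C] by blast
    obtain u' where u': "u' \<in> C" "x u' = x u" using uw(1) by auto
    have "\<rho> (x w) \<in> A" "x (\<rho> (x w)) = x w" using uw(2) \<rho> by (auto simp: A_def)
    moreover have "x w \<notin> x ` C" using uw(2) by blast
    ultimately have "\<rho> (x w) \<in> A - C" "x (\<rho> (x w)) = x w" by (metis DiffI imageI)+
    then show ?thesis using u' uw(3) by (intro bexI[of _ u'] bexI[of _ "\<rho> (x w)"]) auto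
  qed
  have "(\<Prod>r\<in>x ` V. ?q r ^ (k r - 1) / real (k r))
      = (\<Prod>w\<in>V - A. indeg_prob V ?p w)
        * (\<Prod>r\<in>x ` V. real (card {a\<in>A. x a = r}) / real (card {a\<in>V. x a = r}))"
  proof -
    have "(\<Prod>w\<in>V - A. indeg_prob V ?p w) = (\<Prod>w\<in>V - A. ?q (x w))"
      using V by (intro prod.cong) (auto intro: indeg_prob_eq_type k_def)
    also have "\<dots> = (\<Prod>r\<in>UNIV. ?q r ^ card {w\<in>V - A. x w = r})"
      using V by (intro prod_by_type) simp
    also have "\<dots> = (\<Prod>r\<in>x ` V. ?q r ^ card {w\<in>V - A. x w = r})"
    proof (intro prod.mono_neutral_right ballI)
      fix r assume "r \<in> UNIV - x ` V"
      then have "{w\<in>V - A. x w = r} = {}" by auto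
      then show "?q r ^ card {w\<in>V - A. x w = r} = 1" by (simp only: card.empty power_0)
    qed auto
    also have "\<dots> = (\<Prod>r\<in>x ` V. ?q r ^ (k r - 1))"
    proof (intro prod.cong refl)
      fix r assume r: "r \<in> x ` V"
      have "{w\<in>V - A. x w = r} = {w\<in>V. x w = r} - {a\<in>A. x a = r}" by auto
      then have "card {w\<in>V - A. x w = r} = k r - 1"
        unfolding A_type[OF r] k_def using \<rho>[OF r] by (simp add: card_Diff_singleton)
      then show "?q r ^ card {w\<in>V - A. x w = r} = ?q r ^ (k r - 1)" by simp
    qed
    finally show ?thesis by (simp add: prod_dividef A_type k_def)
  qed
  also have "\<dots> \<le> reach_prob V ?p A"
    using V(1) \<pi> AV
  proof (rule reach_prob_ge_prod)
    show "\<exists>a\<in>A. x a = x w" if "w \<in> V" for w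
      using that \<rho> by (intro bexI[of _ "\<rho> (x w)"]) (auto simp: A_def)
  qed
  finally have "c ^ CARD('s) * (\<Prod>r\<in>x ` V. ?q r ^ (k r - 1) / real (k r))
      \<le> c ^ card (A - {v}) * reach_prob V ?p A"
    using c q card_A[of v]
    by (intro mult_mono power_decreasing) (auto intro!: prod_nonneg)
  also have "\<dots> \<le> reach_prob V ?p {v}"
    using V(1) p c(1) AV crossA v by (intro reach_prob_ge_subset) auto
  finally show ?thesis using that v AV unfolding K by blast
qed

section \<open>Transfer to connection probabilities\<close>

lemma compatible_types:
  assumes "compatible x k"
  shows "card {u\<in>{1..total_count k}. x u = s} = k $ s"
  using assms by (simp add: compatible_def)

lemma total_count_pos:
  assumes "k \<noteq> 0"
  shows "total_count k \<ge> 1"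
proof -
  obtain s where "k $ s \<noteq> 0" using assms by (auto simp: vec_eq_iff)
  moreover have "k $ s \<le> total_count k" unfolding total_count_def by (intro member_le_sum) auto
  ultimately show ?thesis by simp
qed

definition edge_prob :: "real^'s^'s \<Rightarrow> nat \<Rightarrow> 's::finite \<Rightarrow> 's \<Rightarrow> real" where
  "edge_prob A N r s = min 1 (A $ r $ s / real N)"

text \<open>The root \<open>v\<close> is kept arbitrary because \<open>reach_prob_ge_types\<close>
  dictates its own.\<close>

lemma conn_prob_eq_reach_prob:
  assumes A: "transpose A = A" "\<And>r s. A $ r $ s \<ge> 0" and k: "k \<noteq> 0" "compatible x k"
    and v: "v \<in> {1..total_count k}"
  shows "conn_prob A N k
    = reach_prob {1..total_count k} (\<lambda>(u, v). edge_prob A N (x u) (x v)) {v}"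
proof -
  let ?B = "(1 / real N) *\<^sub>R A"
  have B: "transpose ?B = ?B" "\<And>r s. ?B $ r $ s \<ge> 0"
    using A by (simp_all add: transpose_def vec_eq_iff)
  show ?thesis
    unfolding conn_prob_eq[OF A(1) k] prob_connected_eq_reach_prob[OF B v] edge_prob_def by simp
qed

lemma edge_prob_bounds: "A $ r $ s \<ge> 0 \<Longrightarrow> edge_prob A N r s \<in> {0..1}"
  by (simp add: edge_prob_def)

theorem conn_prob_le:
  assumes A: "transpose A = A" "\<And>r s. A $ r $ s \<ge> 0" and k: "k \<noteq> 0"
  shows "conn_prob A N k \<le> (\<Prod>r\<in>U. type_indeg_prob (edge_prob A N) (($) k) r ^ (k $ r - 1))"
proof -
  obtain x where x: "compatible x k" using compatible_exists by blast
  have v: "1 \<in> {1..total_count k}" using total_count_pos[OF k] by simp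
  show ?thesis
    unfolding conn_prob_eq_reach_prob[OF A k x v]
    using edge_prob_bounds[OF A(2)] v compatible_types[OF x, symmetric]
    by (intro reach_prob_le_types finite_atLeastAtMost)
qed

text \<open>Some spanning tree has nonzero weight, so \<open>\<kappa>\<close> is positive along all
  its edges. A tree path from \<open>C\<close> to a vertex outside must contain a crossing
  edge.\<close>

lemma tree_weight_pos_imp_crossing:
  fixes \<kappa> :: "real^'s^'s::finite"
  assumes \<kappa>: "transpose \<kappa> = \<kappa>" "\<And>r s. \<kappa> $ r $ s \<ge> 0" and k: "k \<noteq> 0" "compatible x k"
    and pos: "tree_weight \<kappa> k > 0" and C: "C \<subset> {1..total_count k}" "C \<noteq> {}"
  shows "\<exists>u\<in>C. \<exists>v\<in>{1..total_count k} - C. \<kappa> $ x u $ x v > 0"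
proof -
  let ?V = "{1..total_count k}"
  have "(\<Sum>T\<in>spanning_trees (total_count k). \<Prod>e\<in>T. edge_val \<kappa> x e) > 0"
    using pos tree_weight_eq[OF \<kappa>(1) k] by simp
  then obtain T where T: "T \<in> spanning_trees (total_count k)" "(\<Prod>e\<in>T. edge_val \<kappa> x e) \<noteq> 0"
    by (metis (no_types, lifting) less_irrefl sum.neutral)
  have TV: "T \<subseteq> vertex_pairs (total_count k)" "graph_connected ?V T"
    using T(1) by (auto simp: spanning_trees_def)
  have "finite T" using TV(1) finite_vertex_pairs by (rule finite_subset)
  then have edge: "\<kappa> $ x u $ x v > 0" if "{u, v} \<in> T" for u v
    using T(2) that \<kappa>(2)[of "x u" "x v"] edge_val_doubleton[OF \<kappa>(1), of x u v]
    by (auto simp: less_le)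
  obtain u where "u \<in> C" using C(2) by auto
  moreover obtain w where "w \<in> ?V - C" using psubset_imp_ex_mem[OF C(1)] by blast
  ultimately have uw: "u \<in> C" "w \<in> ?V" "w \<notin> C" by auto
  then have "(u, w) \<in> {(a, b). {a, b} \<in> T}\<^sup>*"
    using TV(2) C(1) by (auto simp: graph_connected_def)
  then have "w \<notin> C \<longrightarrow> (\<exists>a\<in>C. \<exists>b\<in>- C. {a, b} \<in> T)"
  proof (induction rule: rtrancl_induct)
    case base
    then show ?case using uw(1) by simp
  next
    case (step y z)
    then show ?case by (cases "y \<in> C") auto
  qed
  then obtain a b where ab: "a \<in> C" "b \<notin> C" "{a, b} \<in> T" using uw(3) by auto
  moreover have "b \<in> ?V" using ab(3) TV(1) by (auto simp: vertex_pairs_def)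
  ultimately show ?thesis using edge[OF ab(3)] by blast
qed

text \<open>Positivity of \<open>tree_weight\<close> supplies the crossing hypothesis of
  \<open>reach_prob_ge_types\<close>; in the application \<open>c\<close> has order
  \<open>1 / N\<close>.\<close>

theorem conn_prob_ge:
  fixes \<kappa> A :: "real^'s^'s::finite"
  assumes A: "transpose A = A" "\<And>r s. A $ r $ s \<ge> 0" and k: "k \<noteq> 0"
    and \<kappa>: "transpose \<kappa> = \<kappa>" "\<And>r s. \<kappa> $ r $ s \<ge> 0" "tree_weight \<kappa> k > 0"
    and c: "0 \<le> c" "c \<le> 1" "\<And>r s. \<kappa> $ r $ s > 0 \<Longrightarrow> c \<le> edge_prob A N r s"
  shows "c ^ CARD('s) * (\<Prod>r | k $ r > 0. type_indeg_prob (edge_prob A N) (($) k) r ^ (k $ r - 1)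
    / real (k $ r)) \<le> conn_prob A N k"
proof -
  let ?V = "{1..total_count k}"
  obtain x where x: "compatible x k" using compatible_exists by blast
  have V: "finite ?V" "?V \<noteq> {}" using total_count_pos[OF k] by auto
  have "\<exists>u\<in>C. \<exists>v\<in>?V - C. c \<le> edge_prob A N (x u) (x v)" if "C \<subset> ?V" "C \<noteq> {}" for C
    using tree_weight_pos_imp_crossing[OF \<kappa>(1,2) k x \<kappa>(3) that] c(3) by blast
  from reach_prob_ge_types[where k = "($) k", OF V edge_prob_bounds[OF A(2)] c(1,2) this
    compatible_types[OF x, symmetric]]
  obtain v where v: "v \<in> ?V" "c ^ CARD('s) * (\<Prod>r | k $ r > 0.
      type_indeg_prob (edge_prob A N) (($) k) r ^ (k $ r - 1) / real (k $ r))
      \<le> reach_prob ?V (\<lambda>(u, v). edge_prob A N (x u) (x v)) {v}"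
    by blast
  then show ?thesis by (simp only: conn_prob_eq_reach_prob[OF A k x v(1)])
qed

text \<open>The crossing lemma, applied to the complement of a single vertex of type
  \<open>r\<close>, yields a vertex with an arc of probability at least \<open>c\<close> into it.
  Two vertices are required for that complement to be nonempty.\<close>

theorem type_indeg_prob_ge:
  fixes \<kappa> A :: "real^'s^'s::finite"
  assumes A: "\<And>r s. A $ r $ s \<ge> 0" and k: "total_count k \<ge> 2" "k $ r > 0"
    and \<kappa>: "transpose \<kappa> = \<kappa>" "\<And>r s. \<kappa> $ r $ s \<ge> 0" "tree_weight \<kappa> k > 0"
    and c: "\<And>r s. \<kappa> $ r $ s > 0 \<Longrightarrow> c \<le> edge_prob A N r s"
  shows "c \<le> type_indeg_prob (edge_prob A N) (($) k) r"
proof -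
  let ?V = "{1..total_count k}" 
  obtain x where x: "compatible x k" using compatible_exists by blast
  have k0: "k \<noteq> 0" using k(2) by auto
  let ?p = "\<lambda>(u, v). edge_prob A N (x u) (x v)"
  have p: "?p i \<in> {0..1}" for i using edge_prob_bounds[OF A] by (auto split: prod.split)
  have "card {u\<in>?V. x u = r} > 0" using k(2) compatible_types[OF x] by simp
  then obtain v where v: "v \<in> ?V" "x v = r" by (auto simp: card_gt_0_iff)
  have "?V - {v} \<subset> ?V" using v(1) by blast
  moreover have "?V - {v} \<noteq> {}"
  proof
    assume "?V - {v} = {}"
    then have "card ?V \<le> card {v}" by (intro card_mono) auto
    then show False using k(1) by simp
  qed
  ultimately obtain u w where "u \<in> ?V - {v}" "w \<in> ?V - (?V - {v})" "\<kappa> $ x u $ x w > 0"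
    using tree_weight_pos_imp_crossing[OF \<kappa>(1,2) k0 x \<kappa>(3), of "?V - {v}"] by blast
  then have u: "u \<in> ?V" "u \<noteq> v" "\<kappa> $ x u $ x v > 0" by auto
  have "c \<le> ?p (u, v)" using c u(3) by simp
  also have "\<dots> \<le> indeg_prob ?V ?p v" using p u by (intro indeg_prob_ge) auto
  also have "\<dots> = type_indeg_prob (edge_prob A N) (($) k) r"
    unfolding v(2)[symmetric]
    using v(1) compatible_types[OF x, symmetric] by (intro indeg_prob_eq_type finite_atLeastAtMost)
  finally show ?thesis .
qed

section \<open>Asymptotics\<close>

text \<open>The logarithm is squeezed by \<open>- p - 2 * p^2 \<le> ln (1 - p) \<le> - p\<close>,
  where \<open>m * p\<close> tends to \<open>a * y\<close> and \<open>p\<close> to 0.\<close>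

lemma one_minus_power_tendsto:
  fixes p :: "nat \<Rightarrow> real" and m :: "nat \<Rightarrow> nat"
  assumes m: "(\<lambda>N. real (m N) / real N) \<longlonglongrightarrow> y"
    and p: "(\<lambda>N. real N * p N) \<longlonglongrightarrow> a" "\<forall>\<^sub>F N in sequentially. p N \<ge> 0"
  shows "(\<lambda>N. (1 - p N) ^ m N) \<longlonglongrightarrow> exp (- (a * y))"
proof -
  have p0: "p \<longlonglongrightarrow> 0"
  proof -
    have "(\<lambda>N. (real N * p N) * inverse (real N)) \<longlonglongrightarrow> a * 0"
      using p(1) lim_inverse_n by (rule tendsto_mult)
    moreover have "\<forall>\<^sub>F N in sequentially. (real N * p N) * inverse (real N) = p N"
      using eventually_gt_at_top[of 0] by eventually_elim simp
    ultimately show ?thesis by (simp add: filterlim_cong)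
  qed
  have pm: "(\<lambda>N. p N * real (m N)) \<longlonglongrightarrow> a * y"
  proof -
    have "(\<lambda>N. (real N * p N) * (real (m N) / real N)) \<longlonglongrightarrow> a * y"
      using p(1) m by (rule tendsto_mult)
    moreover have "\<forall>\<^sub>F N in sequentially. (real N * p N) * (real (m N) / real N) = p N * real (m N)"
      using eventually_gt_at_top[of 0] by eventually_elim simp
    ultimately show ?thesis by (simp add: filterlim_cong)
  qed
  have small: "\<forall>\<^sub>F N in sequentially. p N < 1 / 2"
    using p0 by (rule order_tendstoD(2)) simp
  have "(\<lambda>N. real (m N) * ln (1 - p N)) \<longlonglongrightarrow> - (a * y)"
  proof (rule tendsto_sandwich)
    show "(\<lambda>N. - (p N * real (m N)) - 2 * (p N * (p N * real (m N)))) \<longlonglongrightarrow> - (a * y)"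
      using tendsto_diff[OF tendsto_minus[OF pm] tendsto_mult[OF tendsto_const tendsto_mult[OF p0 pm]], of 2]
      by simp
    show "(\<lambda>N. - (p N * real (m N))) \<longlonglongrightarrow> - (a * y)"
      using pm by (rule tendsto_minus)
    show "\<forall>\<^sub>F N in sequentially.
        - (p N * real (m N)) - 2 * (p N * (p N * real (m N))) \<le> real (m N) * ln (1 - p N)"
      using small p(2)
    proof eventually_elim
      case (elim N)
      then have "- p N - 2 * (p N)\<^sup>2 \<le> ln (1 - p N)"
        by (intro ln_one_minus_pos_lower_bound) auto
      then have "real (m N) * (- p N - 2 * (p N)\<^sup>2) \<le> real (m N) * ln (1 - p N)"
        by (rule mult_left_mono) simp
      then show ?case by (simp add: algebra_simps power2_eq_square)
    qed
    show "\<forall>\<^sub>F N in sequentially. real (m N) * ln (1 - p N) \<le> - (p N * real (m N))"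
      using small p(2)
    proof eventually_elim
      case (elim N)
      then have "ln (1 - p N) \<le> - p N" using ln_le_minus_one[of "1 - p N"] by simp
      then have "real (m N) * ln (1 - p N) \<le> real (m N) * - p N"
        by (rule mult_left_mono) simp
      then show ?case by (simp add: mult.commute)
    qed
  qed
  then have "(\<lambda>N. exp (real (m N) * ln (1 - p N))) \<longlonglongrightarrow> exp (- (a * y))"
    by (rule tendsto_exp)
  moreover have "\<forall>\<^sub>F N in sequentially. exp (real (m N) * ln (1 - p N)) = (1 - p N) ^ m N"
    using small by eventually_elim (simp add: exp_of_nat_mult)
  ultimately show ?thesis by (simp add: filterlim_cong)
qed

text \<open>Covers both the exponent \<open>k r - 1\<close> and the correction
  \<open>of_bool (s = r)\<close>.\<close>

lemma tendsto_diff_one_over: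
  fixes m :: "nat \<Rightarrow> nat"
  assumes "(\<lambda>N. real (m N) / real N) \<longlonglongrightarrow> y" "j \<le> 1"
  shows "(\<lambda>N. real (m N - j) / real N) \<longlonglongrightarrow> y"
proof (rule tendsto_sandwich)
  show "(\<lambda>N. real (m N) / real N - inverse (real N)) \<longlonglongrightarrow> y"
    using tendsto_diff[OF assms(1) lim_inverse_n] by simp
  show "\<forall>\<^sub>F N in sequentially. real (m N) / real N - inverse (real N) \<le> real (m N - j) / real N"
  proof (intro always_eventually allI)
    fix N
    have "(real (m N) - 1) / real N \<le> real (m N - j) / real N"
      using assms(2) by (intro divide_right_mono) auto
    then show "real (m N) / real N - inverse (real N) \<le> real (m N - j) / real N"
      by (simp add: diff_divide_distrib inverse_eq_divide)
  qed
  show "\<forall>\<^sub>F N in sequentially. real (m N - j) / real N \<le> real (m N) / real N"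
    by (intro always_eventually allI divide_right_mono) auto
qed (rule assms(1))

section \<open>Limiting in-degree probabilities and the rate\<close>

locale converging_types =
  fixes \<kappa>N :: "nat \<Rightarrow> real^'s^'s::finite" and \<kappa> :: "real^'s^'s" and y :: "real^'s"
    and kN :: "nat \<Rightarrow> nat^'s"
  assumes \<kappa>N_nonneg: "\<And>N r s. N \<ge> 1 \<Longrightarrow> \<kappa>N N $ r $ s \<ge> 0"
    and \<kappa>N_sym: "\<And>N. N \<ge> 1 \<Longrightarrow> transpose (\<kappa>N N) = \<kappa>N N"
    and \<kappa>_nonneg: "\<And>r s. \<kappa> $ r $ s \<ge> 0"
    and \<kappa>_sym: "transpose \<kappa> = \<kappa>"
    and \<kappa>_lim: "\<And>r s. (\<lambda>N. \<kappa>N N $ r $ s) \<longlonglongrightarrow> \<kappa> $ r $ s"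
    and y_nonneg: "\<And>r. y $ r \<ge> 0"
    and y_nonzero: "y \<noteq> 0"
    and k_lim: "\<And>r. (\<lambda>N. real (kN N $ r) / real N) \<longlonglongrightarrow> y $ r"
begin

definition q :: "nat \<Rightarrow> 's \<Rightarrow> real" where
  "q N r = type_indeg_prob (edge_prob (\<kappa>N N) N) (($) (kN N)) r"

text \<open>The probability that a Poisson variable of mean \<open>(\<kappa> *v y) $ r\<close> is
  nonzero.\<close>

definition q_lim :: "'s \<Rightarrow> real" where
  "q_lim r = 1 - exp (- ((\<kappa> *v y) $ r))"

lemma q_tendsto: "(\<lambda>N. q N r) \<longlonglongrightarrow> q_lim r"
proof -
  have "(\<lambda>N. (1 - edge_prob (\<kappa>N N) N s r) ^ (kN N $ s - of_bool (s = r)))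
      \<longlonglongrightarrow> exp (- (\<kappa> $ s $ r * y $ s))" for s
  proof (rule one_minus_power_tendsto)
    show "(\<lambda>N. real (kN N $ s - of_bool (s = r)) / real N) \<longlonglongrightarrow> y $ s"
      by (rule tendsto_diff_one_over[OF k_lim]) simp
    have "(\<lambda>N. \<kappa>N N $ s $ r * inverse (real N)) \<longlonglongrightarrow> \<kappa> $ s $ r * 0"
      using \<kappa>_lim lim_inverse_n by (rule tendsto_mult)
    then have "\<forall>\<^sub>F N in sequentially. \<kappa>N N $ s $ r * inverse (real N) < 1"
      by (rule order_tendstoD(2)) simp
    \<comment> \<open>The cap in \<open>edge_prob\<close> is eventually inactive.\<close>
    then have "\<forall>\<^sub>F N in sequentially. real N * edge_prob (\<kappa>N N) N s r = \<kappa>N N $ s $ r"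
      using eventually_gt_at_top[of 0]
      by eventually_elim (simp add: edge_prob_def min_def divide_inverse)
    then show "(\<lambda>N. real N * edge_prob (\<kappa>N N) N s r) \<longlonglongrightarrow> \<kappa> $ s $ r"
      using \<kappa>_lim by (simp add: filterlim_cong)
    show "\<forall>\<^sub>F N in sequentially. edge_prob (\<kappa>N N) N s r \<ge> 0"
      using eventually_ge_at_top[of 1]
      by eventually_elim (simp add: edge_prob_def \<kappa>N_nonneg)
  qed
  then have "(\<lambda>N. q N r) \<longlonglongrightarrow> 1 - (\<Prod>s\<in>UNIV. exp (- (\<kappa> $ s $ r * y $ s)))"
    unfolding q_def type_indeg_prob_def by (intro tendsto_intros)
  \<comment> \<open>In-degrees sum over the column \<open>r\<close> of \<open>\<kappa>\<close>,
    whereas \<open>\<kappa> *v y\<close> sums over its row.\<close>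
  moreover have "\<kappa> $ s $ r = \<kappa> $ r $ s" for s
  proof -
    have "transpose \<kappa> $ s $ r = \<kappa> $ s $ r" by (simp only: \<kappa>_sym)
    then show ?thesis by (simp add: transpose_def)
  qed
  ultimately show ?thesis
    by (simp add: q_lim_def matrix_vector_mult_def exp_sum[symmetric] sum_negf)
qed

lemma q_lim_bounds: "0 \<le> q_lim r" "q_lim r \<le> 1"
  using \<kappa>_nonneg y_nonneg by (auto simp: q_lim_def matrix_vector_mult_def sum_nonneg)

lemma q_bounds: "N \<ge> 1 \<Longrightarrow> q N r \<in> {0..1}"
  unfolding q_def by (intro type_indeg_prob_bounds edge_prob_bounds \<kappa>N_nonneg)

lemma supp_nonempty: "supp y \<noteq> {}"
  using y_nonzero y_nonneg by (auto simp: supp_def vec_eq_iff less_le)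

lemma eventually_kN_ge:
  assumes "r \<in> supp y"
  shows "\<forall>\<^sub>F N in sequentially. kN N $ r \<ge> M"
proof -
  have "(\<lambda>N. real M * inverse (real N)) \<longlonglongrightarrow> real M * 0"
    using lim_inverse_n by (intro tendsto_mult tendsto_const)
  then have "(\<lambda>N. real (kN N $ r) / real N - real M * inverse (real N)) \<longlonglongrightarrow> y $ r"
    using tendsto_diff[OF k_lim] by fastforce
  then have "\<forall>\<^sub>F N in sequentially. real (kN N $ r) / real N - real M * inverse (real N) > 0"
    using assms by (intro order_tendstoD(1)) (auto simp: supp_def)
  then show ?thesis using eventually_gt_at_top[of 0]
  proof eventually_elim
    case (elim N)
    then have "real M < real (kN N $ r)" by (simp add: field_simps)
    then show ?case by simp
  qed
qed

lemma eventually_kN_nonzero: "\<forall>\<^sub>F N in sequentially. kN N \<noteq> 0"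
proof -
  obtain r where "r \<in> supp y" using supp_nonempty by auto
  from eventually_kN_ge[OF this, of 1] show ?thesis by eventually_elim auto
qed

lemma conn_rate_eq:
  assumes "\<And>r. r \<in> supp y \<Longrightarrow> q_lim r > 0"
  shows "conn_rate \<kappa> y = ereal (\<Sum>r\<in>supp y. y $ r * ln (q_lim r))"
proof -
  have "conn_rate \<kappa> y = (\<Sum>r\<in>UNIV. ereal (if y $ r = 0 then 0 else y $ r * ln (q_lim r)))"
    unfolding conn_rate_def q_lim_def[symmetric]
  proof (intro sum.cong refl)
    fix r
    show "(if y $ r = 0 then 0 else ereal (y $ r) * elog (q_lim r))
        = ereal (if y $ r = 0 then 0 else y $ r * ln (q_lim r))"
      using assms[of r] y_nonneg[of r] by (cases "y $ r = 0") (simp_all add: supp_def elog_def)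
  qed
  also have "\<dots> = ereal (\<Sum>r\<in>UNIV. if y $ r = 0 then 0 else y $ r * ln (q_lim r))"
    by simp
  also have "(\<Sum>r\<in>UNIV. if y $ r = 0 then 0 else y $ r * ln (q_lim r))
      = (\<Sum>r\<in>supp y. y $ r * ln (q_lim r))"
    using y_nonneg by (intro sum.mono_neutral_cong_right) (auto simp: supp_def less_le)
  finally show ?thesis .
qed

lemma conn_rate_term_le_zero:
  "(if y $ r = 0 then 0 else ereal (y $ r) * elog (1 - exp (- ((\<kappa> *v y) $ r)))) \<le> 0"
  unfolding q_lim_def[symmetric]
  using q_lim_bounds[of r] y_nonneg[of r] by (auto simp: elog_def mult_nonneg_nonpos)

lemma conn_rate_le_zero: "conn_rate \<kappa> y \<le> 0"
  unfolding conn_rate_def by (intro sum_nonpos conn_rate_term_le_zero)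

lemma conn_rate_eq_MInf:
  assumes "r \<in> supp y" "q_lim r = 0"
  shows "conn_rate \<kappa> y = -\<infinity>"
proof -
  let ?t = "\<lambda>r. if y $ r = 0 then 0 else ereal (y $ r) * elog (1 - exp (- ((\<kappa> *v y) $ r)))"
  have "conn_rate \<kappa> y = ?t r + (\<Sum>s\<in>UNIV - {r}. ?t s)"
    unfolding conn_rate_def by (rule sum.remove) auto
  also have "?t r = -\<infinity>"
    using assms unfolding q_lim_def[symmetric] by (auto simp: elog_def supp_def)
  \<comment> \<open>The bound excludes \<open>\<infinity>\<close>, which in \<open>ereal\<close>
    would absorb \<open>-\<infinity>\<close>.\<close>
  also have "(\<Sum>s\<in>UNIV - {r}. ?t s) \<le> 0" by (intro sum_nonpos conn_rate_term_le_zero)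
  then have "-\<infinity> + (\<Sum>s\<in>UNIV - {r}. ?t s) = -\<infinity>" by auto
  finally show ?thesis .
qed

lemma conn_rate_not_dominated:
  assumes "\<not> y \<lless> \<kappa> *v y"
  shows "conn_rate \<kappa> y = -\<infinity>"
proof -
  obtain r where "(\<kappa> *v y) $ r = 0" "y $ r \<noteq> 0" using assms by (auto simp: dominated_def)
  then show ?thesis
    using y_nonneg[of r] by (intro conn_rate_eq_MInf[of r]) (auto simp: supp_def q_lim_def less_le)
qed

section \<open>Upper bound on the exponential scale\<close>

abbreviation rate :: "nat \<Rightarrow> ereal" where
  "rate N \<equiv> ereal (1 / real N) * elog (conn_prob (\<kappa>N N) N (kN N))"

text \<open>Some \<open>q N r\<close> may vanish or tend to 0. Truncating at \<epsilon> from below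
  only weakens the upper bound and makes the logarithms converge.\<close>

lemma limsup_rate_le:
  assumes \<epsilon>: "\<epsilon> > 0"
  shows "limsup rate \<le> ereal (\<Sum>r\<in>supp y. y $ r * ln (max (q_lim r) \<epsilon>))"
proof -
  let ?F = "\<lambda>N. \<Sum>r\<in>supp y. real (kN N $ r - 1) / real N * ln (max (q N r) \<epsilon>)"
  have "\<forall>\<^sub>F N in sequentially. rate N \<le> ereal (?F N)"
    using eventually_kN_nonzero eventually_ge_at_top[of 1]
  proof eventually_elim
    case (elim N)
    let ?P = "conn_prob (\<kappa>N N) N (kN N)"
    show ?case
    proof (cases "?P \<le> 0")
      case True
      then show ?thesis using elim(2) by (simp add: elog_def)
    next
      case False
      have "?P \<le> (\<Prod>r\<in>supp y. q N r ^ (kN N $ r - 1))"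
        unfolding q_def using elim by (intro conn_prob_le \<kappa>N_sym \<kappa>N_nonneg)
      also have "\<dots> \<le> (\<Prod>r\<in>supp y. max (q N r) \<epsilon> ^ (kN N $ r - 1))"
        using q_bounds[OF elim(2)] by (intro prod_mono conjI power_mono) auto
      finally have "ln ?P \<le> ln (\<Prod>r\<in>supp y. max (q N r) \<epsilon> ^ (kN N $ r - 1))"
        using False by (subst ln_le_cancel_iff) auto
      also have "\<dots> = (\<Sum>r\<in>supp y. real (kN N $ r - 1) * ln (max (q N r) \<epsilon>))"
        using \<epsilon> by (subst ln_prod) (auto simp: ln_realpow less_max_iff_disj)
      finally have "1 / real N * ln ?P
          \<le> 1 / real N * (\<Sum>r\<in>supp y. real (kN N $ r - 1) * ln (max (q N r) \<epsilon>))"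
        by (rule mult_left_mono) simp
      then show ?thesis using False by (simp add: elog_def sum_divide_distrib)
    qed
  qed
  then have "limsup rate \<le> limsup (\<lambda>N. ereal (?F N))" by (rule Limsup_mono)
  also have "?F \<longlonglongrightarrow> (\<Sum>r\<in>supp y. y $ r * ln (max (q_lim r) \<epsilon>))"
    using \<epsilon> by (intro tendsto_sum tendsto_mult tendsto_diff_one_over[OF k_lim] tendsto_ln tendsto_max
        q_tendsto tendsto_const) (auto simp: max_def)
  then have "limsup (\<lambda>N. ereal (?F N)) = ereal (\<Sum>r\<in>supp y. y $ r * ln (max (q_lim r) \<epsilon>))"
    by (intro lim_imp_Limsup) auto
  finally show ?thesis .
qed

theorem limsup_rate_le_conn_rate: "limsup rate \<le> conn_rate \<kappa> y"
proof (cases "\<forall>r\<in>supp y. q_lim r > 0")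
  case True
  \<comment> \<open>With this \<epsilon> the truncation has no effect in the limit.\<close>
  define \<epsilon> where "\<epsilon> = Min (q_lim ` supp y)"
  have "\<epsilon> > 0" using True supp_nonempty by (simp add: \<epsilon>_def)
  moreover have "max (q_lim r) \<epsilon> = q_lim r" if "r \<in> supp y" for r
    using that by (auto simp: \<epsilon>_def intro!: max_absorb1)
  ultimately show ?thesis
    using limsup_rate_le[of \<epsilon>] True by (simp add: conn_rate_eq)
next
  case False
  then obtain r where r: "r \<in> supp y" "q_lim r = 0" using q_lim_bounds(1) by (auto simp: less_le)
  have y: "y $ r > 0" using r(1) by (simp add: supp_def)
  have "limsup rate \<le> ereal B" for B
  proof -
    \<comment> \<open>Chosen so that \<open>y $ r * ln \<epsilon> = - \<bar>B\<bar>\<close>; as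
      \<epsilon> is at most 1, the other terms stay nonpositive.\<close>
    define \<epsilon> where "\<epsilon> = exp (- (\<bar>B\<bar> / y $ r))"
    have \<epsilon>: "0 < \<epsilon>" "\<epsilon> \<le> 1" using y by (simp_all add: \<epsilon>_def)
    have "(\<Sum>s\<in>supp y. y $ s * ln (max (q_lim s) \<epsilon>)) = y $ r * ln (max (q_lim r) \<epsilon>)
        + (\<Sum>s\<in>supp y - {r}. y $ s * ln (max (q_lim s) \<epsilon>))"
      using r(1) by (intro sum.remove) auto
    also have "(\<Sum>s\<in>supp y - {r}. y $ s * ln (max (q_lim s) \<epsilon>)) \<le> 0"
      using \<epsilon> q_lim_bounds(2) y_nonneg
      by (intro sum_nonpos mult_nonneg_nonpos) (auto simp: less_max_iff_disj)
    also have "y $ r * ln (max (q_lim r) \<epsilon>) + 0 = - \<bar>B\<bar>"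
      using \<epsilon> r(2) y by (simp add: \<epsilon>_def max_def)
    finally have "(\<Sum>s\<in>supp y. y $ s * ln (max (q_lim s) \<epsilon>)) \<le> B" by simp
    then show ?thesis using limsup_rate_le[OF \<epsilon>(1)] order_trans by fastforce
  qed
  then have "limsup rate = -\<infinity>" by (rule ereal_bot)
  then show ?thesis by simp
qed

section \<open>Lower bound on the exponential scale and the limit\<close>

lemma edge_prob_lower_bound:
  obtains c where "0 < c" "c \<le> 1"
    "\<forall>\<^sub>F N in sequentially. \<forall>r s. \<kappa> $ r $ s > 0 \<longrightarrow> c / real N \<le> edge_prob (\<kappa>N N) N r s"
proof -
  let ?S = "{\<kappa> $ r $ s | r s. \<kappa> $ r $ s > 0}"
  \<comment> \<open>Inserting 1 makes the finite set nonempty and gives \<open>c \<le> 1\<close>;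
    halving leaves room for \<open>\<kappa>N N\<close> to differ from its limit.\<close>
  define m where "m = Min (insert 1 ?S)"
  define c where "c = m / 2"
  have "?S = (\<lambda>(r, s). \<kappa> $ r $ s) ` {(r, s). \<kappa> $ r $ s > 0}" by auto
  then have fin: "finite (insert 1 ?S)" by simp
  have m: "0 < m" unfolding m_def using fin by (subst Min_gr_iff) auto
  have m1: "m \<le> 1" unfolding m_def using fin by (intro Min_le) auto
  have mS: "m \<le> \<kappa> $ r $ s" if "\<kappa> $ r $ s > 0" for r s
    unfolding m_def using fin that by (intro Min_le) auto
  have "\<forall>\<^sub>F N in sequentially. \<kappa> $ r $ s > 0 \<longrightarrow> c \<le> \<kappa>N N $ r $ s" for r s
  proof (cases "\<kappa> $ r $ s > 0")
    case True
    then have "c < \<kappa> $ r $ s" using mS[OF True] m by (simp add: c_def)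
    from order_tendstoD(1)[OF \<kappa>_lim this] show ?thesis by eventually_elim simp
  qed simp
  then have "\<forall>\<^sub>F N in sequentially. \<forall>r s. \<kappa> $ r $ s > 0 \<longrightarrow> c \<le> \<kappa>N N $ r $ s"
    by (intro eventually_all_finite)
  then have "\<forall>\<^sub>F N in sequentially. \<forall>r s. \<kappa> $ r $ s > 0 \<longrightarrow> c / real N \<le> edge_prob (\<kappa>N N) N r s"
    using eventually_ge_at_top[of 1]
  proof eventually_elim
    case (elim N)
    have "c / real N \<le> 1" using m m1 elim(2) by (simp add: c_def divide_le_eq)
    then show ?case using elim by (auto simp: edge_prob_def divide_right_mono)
  qed
  then show ?thesis using that[of c] m m1 by (simp add: c_def)
qed

text \<open>Logarithms are taken in \<open>conn_prob_ge\<close> with \<open>c / N\<close> for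
  \<open>c\<close>. Besides the main terms there remain only multiples of \<open>ln (c / N)\<close>,
  constants and the \<open>ln (kN N $ r)\<close>, all of which vanish after division by
  \<open>N\<close>. For types outside \<open>supp y\<close>, boundedness allows at most
  \<open>B r\<close> factors, each at least \<open>c / N\<close>.\<close>

lemma liminf_rate_ge:
  assumes tree: "\<forall>\<^sub>F N in sequentially. tree_weight \<kappa> (kN N) > 0"
    and bdd: "\<And>r N. r \<notin> supp y \<Longrightarrow> N \<ge> 1 \<Longrightarrow> kN N $ r \<le> B r"
    and pos: "\<And>r. r \<in> supp y \<Longrightarrow> q_lim r > 0"
  shows "ereal (\<Sum>r\<in>supp y. y $ r * ln (q_lim r)) \<le> liminf rate"
proof -
  obtain c where c: "0 < c" "c \<le> 1"
    "\<forall>\<^sub>F N in sequentially. \<forall>r s. \<kappa> $ r $ s > 0 \<longrightarrow> c / real N \<le> edge_prob (\<kappa>N N) N r s"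
    by (rule edge_prob_lower_bound)
  obtain r0 where r0: "r0 \<in> supp y" using supp_nonempty by auto
  let ?l = "\<lambda>N. ln (c / real N)"
  let ?g = "\<lambda>N r. real (kN N $ r - 1) * ln (q N r) - ln (real (kN N $ r))"
  \<comment> \<open>\<open>B r + 1\<close> keeps the argument of \<open>ln\<close> positive when
    \<open>B r = 0\<close>. \<open>?G'\<close> is \<open>?G\<close> with the division distributed,
    ready for termwise limits.\<close>
  let ?G = "\<lambda>N. 1 / real N * (real CARD('s) * ?l N + ((\<Sum>r\<in>supp y. ?g N r)
    + (\<Sum>r\<in>-supp y. real (B r) * ?l N - ln (real (B r + 1)))))"
  let ?G' = "\<lambda>N. real CARD('s) * (?l N / real N)
    + ((\<Sum>r\<in>supp y. real (kN N $ r - 1) / real N * ln (q N r) - ln (real (kN N $ r)) / real N)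
    + (\<Sum>r\<in>-supp y. real (B r) * (?l N / real N) - ln (real (B r + 1)) * inverse (real N)))"
  have "\<forall>\<^sub>F N in sequentially. ereal (?G N) \<le> rate N"
    using tree c(3) eventually_kN_ge[OF r0, of 2] eventually_ge_at_top[of 1]
  proof eventually_elim
    case (elim N)
    let ?P = "conn_prob (\<kappa>N N) N (kN N)" and ?c = "c / real N"
    have k0: "kN N \<noteq> 0" using elim(3) by auto
    have "kN N $ r0 \<le> total_count (kN N)"
      unfolding total_count_def by (intro member_le_sum) auto
    with elim(3) have two: "total_count (kN N) \<ge> 2" by simp
    have c01: "0 < ?c" "?c \<le> 1" using c elim(4) by (simp_all add: divide_le_eq)
    \<comment> \<open>Makes the logarithms below meaningful and also controls the types outside
      \<open>supp y\<close>, where nothing is assumed on \<open>q_lim\<close>.\<close>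
    have qc: "?c \<le> q N r" if "kN N $ r > 0" for r
      unfolding q_def using two that elim(1,2,4) \<kappa>_sym \<kappa>_nonneg \<kappa>N_nonneg
      by (intro type_indeg_prob_ge[where \<kappa> = \<kappa>]) auto
    have ge: "?c ^ CARD('s) * (\<Prod>r | kN N $ r > 0. q N r ^ (kN N $ r - 1) / real (kN N $ r)) \<le> ?P"
      unfolding q_def using k0 elim(1,2,4) \<kappa>_sym \<kappa>_nonneg \<kappa>N_nonneg \<kappa>N_sym c01
      by (intro conn_prob_ge[where \<kappa> = \<kappa>]) auto
    have factor: "q N r ^ (kN N $ r - 1) / real (kN N $ r) > 0" if "kN N $ r > 0" for r
      using qc[OF that] that c01(1) by (intro divide_pos_pos zero_less_power) auto
    then have prod_pos: "(\<Prod>r | kN N $ r > 0. q N r ^ (kN N $ r - 1) / real (kN N $ r)) > 0"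
      by (intro prod_pos) auto
    with ge c01(1) have P: "?P > 0"
      by (meson less_le_trans mult_pos_pos zero_less_power)
    have "real CARD('s) * ln ?c + (\<Sum>r | kN N $ r > 0. ?g N r)
        = ln (?c ^ CARD('s) * (\<Prod>r | kN N $ r > 0. q N r ^ (kN N $ r - 1) / real (kN N $ r)))"
    proof -
      have "ln (q N r ^ (kN N $ r - 1) / real (kN N $ r)) = ?g N r" if "kN N $ r > 0" for r
      proof -
        have "q N r > 0" using qc[OF that] c01(1) by simp
        then show ?thesis using that by (subst ln_div) (auto simp: ln_realpow)
      qed
      then have "ln (\<Prod>r | kN N $ r > 0. q N r ^ (kN N $ r - 1) / real (kN N $ r))
          = (\<Sum>r | kN N $ r > 0. ?g N r)"
        using factor by (subst ln_prod) (simp, metis less_irrefl mem_Collect_eq, simp)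
      then show ?thesis
        using c01(1) prod_pos by (subst ln_mult_pos) (auto simp: ln_realpow)
    qed
    also have "\<dots> \<le> ln ?P"
      using ge P c01(1) prod_pos by (subst ln_le_cancel_iff) (auto intro!: mult_pos_pos)
    finally have "real CARD('s) * ln ?c + (\<Sum>r | kN N $ r > 0. ?g N r) \<le> ln ?P" .
    moreover have "(\<Sum>r\<in>supp y. ?g N r) + (\<Sum>r\<in>-supp y. real (B r) * ?l N - ln (real (B r + 1)))
        \<le> (\<Sum>r | kN N $ r > 0. ?g N r)"
    proof -
      have "real (B r) * ?l N - ln (real (B r + 1)) \<le> ?g N r" if "r \<notin> supp y" for r
      proof (cases "kN N $ r > 0")
        case True
        have kB: "kN N $ r \<le> B r" using bdd[OF that elim(4)] .
        have "real (B r) * ln ?c \<le> real (kN N $ r - 1) * ln ?c"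
          using kB c01 by (intro mult_right_mono_neg) auto
        also have "\<dots> \<le> real (kN N $ r - 1) * ln (q N r)"
          using qc[OF True] c01(1) by (intro mult_left_mono) auto
        finally have "real (B r) * ln ?c \<le> real (kN N $ r - 1) * ln (q N r)" .
        moreover have "ln (real (kN N $ r)) \<le> ln (real (B r + 1))"
          using True kB by (subst ln_le_cancel_iff) auto
        ultimately show ?thesis by simp
      next
        case False
        \<comment> \<open>For \<open>kN N $ r = 0\<close> the term \<open>?g N r\<close> is 0, by
          truncated subtraction and \<open>ln 0 = 0\<close>, so the left side has to be
          nonpositive.\<close>
        have "real (B r) * ln ?c \<le> 0" using c01 by (intro mult_nonneg_nonpos) auto
        moreover have "ln (real (B r + 1)) \<ge> 0" by simp
        ultimately have "real (B r) * ?l N - ln (real (B r + 1)) \<le> 0" by linarith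
        then show ?thesis using False by simp
      qed
      then have "(\<Sum>r\<in>supp y. ?g N r) + (\<Sum>r\<in>-supp y. real (B r) * ?l N - ln (real (B r + 1)))
          \<le> (\<Sum>r\<in>supp y. ?g N r) + (\<Sum>r\<in>-supp y. ?g N r)"
        by (intro add_left_mono sum_mono) auto
      also have "\<dots> = (\<Sum>r\<in>supp y \<union> - supp y. ?g N r)"
        by (rule sum.union_disjoint[symmetric]) auto
      also have "\<dots> = (\<Sum>r | kN N $ r > 0. ?g N r)"
        by (rule sum.mono_neutral_right) auto
      finally show ?thesis .
    qed
    ultimately have "real CARD('s) * ?l N + ((\<Sum>r\<in>supp y. ?g N r)
        + (\<Sum>r\<in>-supp y. real (B r) * ?l N - ln (real (B r + 1)))) \<le> ln ?P"
      by linarith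
    then have "?G N \<le> 1 / real N * ln ?P" by (rule mult_left_mono) simp
    then show ?case using P by (simp add: elog_def)
  qed
  then have "liminf (\<lambda>N. ereal (?G N)) \<le> liminf rate" by (rule Liminf_mono)
  moreover have "?G \<longlonglongrightarrow> (\<Sum>r\<in>supp y. y $ r * ln (q_lim r))"
  proof -
    have l0: "(\<lambda>N. ?l N / real N) \<longlonglongrightarrow> 0"
    proof -
      have "(\<lambda>N. ln c * inverse (real N) - ln (real N) / real N) \<longlonglongrightarrow> ln c * 0 - 0"
        by (intro tendsto_intros lim_inverse_n lim_ln_over_n)
      moreover have "\<forall>\<^sub>F N in sequentially.
          ln c * inverse (real N) - ln (real N) / real N = ?l N / real N"
        using eventually_gt_at_top[of 0]
        by eventually_elim (use c(1) in \<open>simp add: ln_div field_simps\<close>)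
      ultimately show ?thesis by (simp add: filterlim_cong)
    qed
    \<comment> \<open>Writing \<open>ln k\<close> as \<open>ln (k / N) + ln N\<close> uses that
      \<open>k / N\<close> has a positive limit on \<open>supp y\<close>.\<close>
    have k0: "(\<lambda>N. ln (real (kN N $ r)) / real N) \<longlonglongrightarrow> 0" if "r \<in> supp y" for r
    proof -
      have "(\<lambda>N. ln (real (kN N $ r) / real N) * inverse (real N) + ln (real N) / real N)
          \<longlonglongrightarrow> ln (y $ r) * 0 + 0"
        using that
        by (intro tendsto_intros lim_inverse_n lim_ln_over_n k_lim) (auto simp: supp_def)
      moreover have "\<forall>\<^sub>F N in sequentially.
          ln (real (kN N $ r) / real N) * inverse (real N) + ln (real N) / real N
            = ln (real (kN N $ r)) / real N"
        using eventually_gt_at_top[of 0] eventually_kN_ge[OF that, of 1]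
        by eventually_elim (simp add: ln_div field_simps)
      ultimately show ?thesis by (simp add: filterlim_cong)
    qed
    have "?G' \<longlonglongrightarrow> real CARD('s) * 0 + ((\<Sum>r\<in>supp y. y $ r * ln (q_lim r) - 0)
        + (\<Sum>r\<in>-supp y. real (B r) * 0 - ln (real (B r + 1)) * 0))"
      using pos
      by (intro tendsto_add tendsto_mult tendsto_diff tendsto_sum tendsto_const tendsto_ln l0 k0
          lim_inverse_n q_tendsto tendsto_diff_one_over[OF k_lim]) (auto dest: pos)
    moreover have "?G' N = ?G N" for N
      by (simp add: sum_divide_distrib diff_divide_distrib add_divide_distrib inverse_eq_divide)
    ultimately show ?thesis by simp
  qed
  then have "liminf (\<lambda>N. ereal (?G N)) = ereal (\<Sum>r\<in>supp y. y $ r * ln (q_lim r))"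
    by (intro lim_imp_Liminf) auto
  ultimately show ?thesis by simp
qed

text \<open>If \<open>q_lim\<close> vanishes somewhere on \<open>supp y\<close>, the rate is
  \<open>-\<infinity>\<close> and the lower bound is trivial; otherwise
  \<open>liminf_rate_ge\<close> applies.\<close>

theorem rate_tendsto:
  assumes tree: "\<forall>\<^sub>F N in sequentially. tree_weight \<kappa> (kN N) > 0"
    and bdd: "\<forall>r. r \<notin> supp y \<longrightarrow> (\<exists>B. \<forall>N\<ge>1. kN N $ r \<le> B)"
  shows "rate \<longlonglongrightarrow> conn_rate \<kappa> y"
proof -
  have "conn_rate \<kappa> y \<le> liminf rate"
  proof (cases "\<forall>r\<in>supp y. q_lim r > 0")
    case True
    obtain B where "\<And>r N. r \<notin> supp y \<Longrightarrow> N \<ge> 1 \<Longrightarrow> kN N $ r \<le> B r" using bdd by metis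
    with True show ?thesis
      using liminf_rate_ge[OF tree, of B] by (simp add: conn_rate_eq)
  next
    case False
    then obtain r where "r \<in> supp y" "q_lim r = 0" using q_lim_bounds(1) by (auto simp: less_le)
    then show ?thesis by (simp add: conn_rate_eq_MInf)
  qed
  then have "liminf rate = conn_rate \<kappa> y" "limsup rate = conn_rate \<kappa> y"
    using limsup_rate_le_conn_rate Liminf_le_Limsup[of sequentially rate] by auto
  then show ?thesis by (simp add: tendsto_iff_Liminf_eq_Limsup)
qed

end

theorem theorem3p6:
  fixes \<kappa>N :: "nat \<Rightarrow> real^'s^'s::finite"
    and \<kappa> :: "real^'s^'s"
    and y :: "real^'s"
    and kN :: "nat \<Rightarrow> nat^'s"
  assumes \<kappa>N_nonneg: "\<And>N r s. N \<ge> 1 \<Longrightarrow> \<kappa>N N $ r $ s \<ge> 0"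
    and \<kappa>N_sym: "\<And>N. N \<ge> 1 \<Longrightarrow> transpose (\<kappa>N N) = \<kappa>N N"
    and \<kappa>_nonneg: "\<And>r s. \<kappa> $ r $ s \<ge> 0"
    and \<kappa>_sym: "transpose \<kappa> = \<kappa>"
    and \<kappa>_lim: "\<And>r s. (\<lambda>N. \<kappa>N N $ r $ s) \<longlonglongrightarrow> \<kappa> $ r $ s"
    and y_range: "\<And>r. y $ r \<in> {0..1}"
    and y_nonzero: "y \<noteq> 0"
    and k_lim: "\<And>r. (\<lambda>N. real (kN N $ r) / real N) \<longlonglongrightarrow> y $ r"
  shows
    "(limsup (\<lambda>N. ereal (1 / real N) * elog (conn_prob (\<kappa>N N) N (kN N))) \<le> conn_rate \<kappa> y
      \<and> (\<not> y \<lless> \<kappa> *v y \<longrightarrow> conn_rate \<kappa> y = -\<infinity>))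
     \<and> ((\<forall>\<^sub>F N in sequentially. tree_weight \<kappa> (kN N) > 0) \<and>
         (\<forall>r. r \<notin> supp y \<longrightarrow> (\<exists>B. \<forall>N\<ge>1. kN N $ r \<le> B)) \<longrightarrow>
         (\<lambda>N. ereal (1 / real N) * elog (conn_prob (\<kappa>N N) N (kN N))) \<longlonglongrightarrow> conn_rate \<kappa> y
         \<and> conn_rate \<kappa> y \<in> {-\<infinity>..0}
         \<and> (\<not> y \<lless> \<kappa> *v y \<longrightarrow> conn_rate \<kappa> y = -\<infinity>))"
proof -
  interpret converging_types \<kappa>N \<kappa> y kN
    using assms by unfold_locales auto
  show ?thesis
    using limsup_rate_le_conn_rate conn_rate_not_dominated rate_tendsto conn_rate_le_zero by auto
qed

end
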